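(* Let $k$ be a field, $n\ge 1$, let $\Delta$ be a matroid on $[n]$, and let $I=I_\Delta\subseteq R=k[x_1,\ldots,x_n]$ be its Stanley--Reisner ideal. Then for every $\ell\ge 1$ the set $G(I^{(\ell)})$ consists precisely of the monomials $m$ of the form $m=m_1\cdots m_s$, where each $m_i$ is a squarefree monomial belonging to $G(I^{(c_i)})$ for some integer $c_i$ with $1\le c_i\le \operatorname{ht} I$, where $\sum_{i=1}^s c_i=\ell$, and where $\operatorname{supp}(m_1)\supseteq \operatorname{supp}(m_2)\supseteq\cdots\supseteq \operatorname{supp}(m_s)$.
   Context: A matroid on $[n]=\{1,\ldots,n\}$ is identified with its independence complex, i.e. the simplicial complex whose facets are the bases of the matroid (loops are allowed, so a one-element subset of $[n]$ need not be a face). For $F\subseteq[n]$ put $\mathfrak p_F=(x_i: i\in F)\subseteq R$. The Stanley--Reisner ideal is $I_\Delta=\bigcap_F \mathfrak p_{[n]-F}$, intersection over the facets $F$ of $\Delta$. For a squarefree monomial ideal $I$, the $\ell$-th symbolic power is $I^{(\ell)}=\bigcap_{\mathfrak p\in\operatorname{Ass}(R/I)}\mathfrak p^\ell$. For a monomial ideal $L$, $G(L)$ denotes its unique minimal generating set consisting of monomials. For a monomial $m$, $\operatorname{supp}(m)$ is the set of variables dividing $m$. $\operatorname{ht} I$ is the height of $I$. *)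

theory Defs
  imports
    "HOL-Algebra.Algebra"
    "HOL-Library.Poly_Mapping"
    "HOL-Library.Extended_Nat"
begin

section \<open>Ideals of a commutative ring\<close>

text \<open>The set \<open>{r. r \<otimes> f \<in> I}\<close> is the annihilator of the class of \<open>f\<close> in the module \<open>R/I\<close>.\<close>

definition associated_primes :: "('a, 'b) ring_scheme \<Rightarrow> 'a set \<Rightarrow> 'a set set" where
  "associated_primes R I =
     {P. primeideal P R \<and> (\<exists>f\<in>carrier R. P = {r \<in> carrier R. r \<otimes>\<^bsub>R\<^esub> f \<in> I})}"

text \<open>The power of the ideal \<open>P\<close> is taken in the multiplicative monoid of ideals. Intersecting with
  the carrier only matters for \<open>I = R\<close>, where there are no associated primes.\<close>

definition symbolic_power :: "('a, 'b) ring_scheme \<Rightarrow> 'a set \<Rightarrow> nat \<Rightarrow> 'a set" where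
  "symbolic_power R I l =
     carrier R \<inter> (\<Inter>P\<in>associated_primes R I. P [^]\<^bsub>ideals_set R\<^esub> l)"

definition prime_height :: "('a, 'b) ring_scheme \<Rightarrow> 'a set \<Rightarrow> enat" where
  "prime_height R P =
     Sup {enat m |m. \<exists>Q :: nat \<Rightarrow> 'a set.
       (\<forall>i\<le>m. primeideal (Q i) R) \<and> (\<forall>i<m. Q i \<subset> Q (Suc i)) \<and> Q m = P}"

definition ideal_height :: "('a, 'b) ring_scheme \<Rightarrow> 'a set \<Rightarrow> enat" where
  "ideal_height R I = Inf {prime_height R P |P. primeideal P R \<and> I \<subseteq> P}"


section \<open>Polynomial rings and monomials\<close>

text \<open>An exponent vector has type \<open>nat \<Rightarrow>\<^sub>0 nat\<close>, so \<open>(nat \<Rightarrow>\<^sub>0 nat) \<Rightarrow>\<^sub>0 'k\<close> is the type of polynomials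
  over \<open>'k\<close> in variables indexed by all natural numbers; \<open>k[x\<^sub>1,\<dots>,x\<^sub>n]\<close> is its
  subring of polynomials in which only the variables with index in \<open>{1..n}\<close> occur.\<close>

type_synonym 'k mpoly = "(nat \<Rightarrow>\<^sub>0 nat) \<Rightarrow>\<^sub>0 'k"

definition mpoly_ring :: "nat \<Rightarrow> ('k::field) mpoly ring" where
  "mpoly_ring n =
     \<lparr>carrier = {p. \<forall>a\<in>Poly_Mapping.keys p. Poly_Mapping.keys a \<subseteq> {1..n}},
      monoid.mult = (*), one = 1, ring.zero = 0, add = (+)\<rparr>"

definition var :: "nat \<Rightarrow> ('k::field) mpoly" where
  "var i = Poly_Mapping.single (Poly_Mapping.single i 1) 1"

definition monomials :: "nat \<Rightarrow> ('k::field) mpoly set" where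
  "monomials n = {Poly_Mapping.single a 1 |a. Poly_Mapping.keys a \<subseteq> {1..n}}"

definition squarefree_monomials :: "nat \<Rightarrow> ('k::field) mpoly set" where
  "squarefree_monomials n = {\<Prod>i\<in>S. var i |S. S \<subseteq> {1..n}}"

definition supp :: "nat \<Rightarrow> ('k::field) mpoly \<Rightarrow> 'k mpoly set" where
  "supp n m = {var i |i. i \<in> {1..n} \<and> var i divides\<^bsub>mpoly_ring n\<^esub> m}"

text \<open>Meaningful for monomial ideals \<open>L\<close>, for which the set described exists and is unique.\<close>

definition min_gens :: "nat \<Rightarrow> ('k::field) mpoly set \<Rightarrow> 'k mpoly set" where
  "min_gens n L =
     (THE A. A \<subseteq> monomials n \<and> Idl\<^bsub>mpoly_ring n\<^esub> A = L \<and>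
             (\<forall>B. B \<subset> A \<longrightarrow> Idl\<^bsub>mpoly_ring n\<^esub> B \<noteq> L))"


section \<open>Matroids and Stanley--Reisner ideals\<close>

text \<open>The independent sets of a matroid on \<open>{1..n}\<close>. Singletons need not be
  independent, i.e. loops are allowed.\<close>

definition matroid :: "nat \<Rightarrow> nat set set \<Rightarrow> bool" where
  "matroid n \<Delta> \<longleftrightarrow>
     \<Delta> \<subseteq> Pow {1..n} \<and> {} \<in> \<Delta> \<and>
     (\<forall>F\<in>\<Delta>. \<forall>G. G \<subseteq> F \<longrightarrow> G \<in> \<Delta>) \<and>
     (\<forall>F\<in>\<Delta>. \<forall>G\<in>\<Delta>. card F < card G \<longrightarrow> (\<exists>x\<in>G - F. insert x F \<in> \<Delta>))"

definition facets :: "'v set set \<Rightarrow> 'v set set" where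
  "facets \<Delta> = {F \<in> \<Delta>. \<forall>G\<in>\<Delta>. F \<subseteq> G \<longrightarrow> G = F}"

definition var_ideal :: "nat \<Rightarrow> nat set \<Rightarrow> ('k::field) mpoly set" where
  "var_ideal n F = Idl\<^bsub>mpoly_ring n\<^esub> (var ` F)"

definition stanley_reisner_ideal :: "nat \<Rightarrow> nat set set \<Rightarrow> ('k::field) mpoly set" where
  "stanley_reisner_ideal n \<Delta> = (\<Inter>F\<in>facets \<Delta>. var_ideal n ({1..n} - F))"

end

theory Submission
  imports Defs
begin

text \<open>The associated primes of \<open>I\<close> are the ideals generated by the variables outside a facet \<open>F\<close>, so
  \<open>x\<^sup>a\<close> lies in the \<open>l\<close>-th symbolic power iff the weight of \<open>a\<close> outside every facet is at least \<open>l\<close>.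
  Decompose \<open>a\<close> into its layers \<open>S\<^sub>j = {i. a\<^sub>i > j}\<close>, a decreasing chain. By the greedy algorithm one facet
  minimises \<open>card (S\<^sub>j - F)\<close> for all \<open>j\<close> at once, so the minimal weight of \<open>a\<close> is the sum of the nullities
  of the layers. Lowering \<open>a\<^sub>i\<close> by one removes \<open>i\<close> from the innermost layer containing it, and if removing \<open>i\<close>
  lowers the nullity of a set, it lowers that of every larger set. Hence \<open>x\<^sup>a\<close> is a minimal generator
  iff the nullities of the layers add up to \<open>l\<close> and every layer loses nullity when any of its elements
  is removed; the latter says that the layer is a squarefree minimal generator for the exponent
  given by its nullity. Only the lower bound for the height of \<open>I\<close> matters, and it comes from chains of ideals
  generated by variables.\<close>

section \<open>Nullity in a matroid\<close>

text \<open>For a matroid and a finite \<open>S\<close> this is \<open>card S\<close> minus the rank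
  of \<open>S\<close>. Written as a minimum over facets, it is the least weight of the squarefree
  monomial on \<open>S\<close> among the associated primes.\<close>

definition nullity :: "'v set set \<Rightarrow> 'v set \<Rightarrow> nat" where
  "nullity \<Delta> S = Min ((\<lambda>F. card (S - F)) ` facets \<Delta>)"

lemma matroid_finite: "matroid n \<Delta> \<Longrightarrow> finite \<Delta>"
  unfolding matroid_def by (meson finite_Pow_iff finite_atLeastAtMost finite_subset)

lemma matroid_subset: "matroid n \<Delta> \<Longrightarrow> F \<in> \<Delta> \<Longrightarrow> F \<subseteq> {1..n}"
  unfolding matroid_def by blast

lemma matroid_down: "matroid n \<Delta> \<Longrightarrow> F \<in> \<Delta> \<Longrightarrow> G \<subseteq> F \<Longrightarrow> G \<in> \<Delta>"
  unfolding matroid_def by blast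

lemma matroid_augment:
  "matroid n \<Delta> \<Longrightarrow> F \<in> \<Delta> \<Longrightarrow> G \<in> \<Delta> \<Longrightarrow> card F < card G \<Longrightarrow> \<exists>x\<in>G - F. insert x F \<in> \<Delta>"
  unfolding matroid_def by blast

text \<open>Take an independent set of largest cardinality between \<open>J\<close> and
  \<open>S\<close>. Were some independent \<open>G\<close> inside \<open>S\<close> larger,
  augmenting from \<open>G\<close> would enlarge it without leaving \<open>S\<close>.\<close>

lemma matroid_extend:
  assumes M: "matroid n \<Delta>" and J: "J \<in> \<Delta>" "J \<subseteq> S"
  obtains J' where "J' \<in> \<Delta>" "J \<subseteq> J'" "J' \<subseteq> S" "\<And>G. G \<in> \<Delta> \<Longrightarrow> G \<subseteq> S \<Longrightarrow> card G \<le> card J'"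
proof -
  let ?X = "{K \<in> \<Delta>. J \<subseteq> K \<and> K \<subseteq> S}"
  have "finite ?X" "?X \<noteq> {}" using matroid_finite[OF M] J by auto
  then obtain J' where J': "J' \<in> ?X" "\<And>K. K \<in> ?X \<Longrightarrow> card K \<le> card J'"
    using obtains_MAX[of ?X card] by (metis (no_types, lifting) Max_ge finite_imageI imageI)
  have "card G \<le> card J'" if G: "G \<in> \<Delta>" "G \<subseteq> S" for G
  proof (rule ccontr)
    assume "\<not> card G \<le> card J'"
    then obtain x where x: "x \<in> G - J'" "insert x J' \<in> \<Delta>"
      using matroid_augment[OF M, of J' G] J'(1) G(1) by (metis (no_types, lifting) mem_Collect_eq not_le)
    have "finite J'"
      using J'(1) matroid_subset[OF M, of J'] by (auto intro: finite_subset)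
    moreover have "insert x J' \<in> ?X" using x G J'(1) by auto
    ultimately show False using J'(2)[of "insert x J'"] x by auto
  qed
  then show ?thesis using that J'(1) by blast
qed

lemma facets_nonempty: "matroid n \<Delta> \<Longrightarrow> facets \<Delta> \<noteq> {}"
proof -
  assume M: "matroid n \<Delta>"
  then have "{} \<in> \<Delta>" unfolding matroid_def by blast
  then obtain F where F: "F \<in> \<Delta>" "\<And>G. G \<in> \<Delta> \<Longrightarrow> card G \<le> card F"
    using matroid_extend[OF M, of "{}" "{1..n}"] matroid_subset[OF M] by (metis empty_subsetI)
  have "F \<in> facets \<Delta>"
    unfolding facets_def
    using F matroid_subset[OF M] by (auto dest!: card_seteq[rotated, OF _ F(2)] intro: finite_subset)
  then show ?thesis by blast
qed

lemma finite_facets: "matroid n \<Delta> \<Longrightarrow> finite (facets \<Delta>)"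
  unfolding facets_def using matroid_finite by auto

lemma facet_subset: "matroid n \<Delta> \<Longrightarrow> F \<in> facets \<Delta> \<Longrightarrow> F \<subseteq> {1..n}"
  unfolding facets_def using matroid_subset by blast

lemma nullity_le: "matroid n \<Delta> \<Longrightarrow> F \<in> facets \<Delta> \<Longrightarrow> nullity \<Delta> S \<le> card (S - F)"
  unfolding nullity_def by (simp add: finite_facets)

lemma nullity_obtain:
  assumes "matroid n \<Delta>"
  obtains F where "F \<in> facets \<Delta>" "nullity \<Delta> S = card (S - F)"
proof -
  have "nullity \<Delta> S \<in> (\<lambda>F. card (S - F)) ` facets \<Delta>"
    unfolding nullity_def using assms by (intro Min_in) (simp_all add: finite_facets facets_nonempty)
  then show ?thesis using that by blast
qed

lemma nullity_empty: "matroid n \<Delta> \<Longrightarrow> nullity \<Delta> {} = 0"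
  using nullity_obtain[of n \<Delta> "{}"] by auto

text \<open>A facet that is optimal for \<open>S - {i}\<close> misses at most one more element of
  \<open>S\<close>, namely \<open>i\<close>.\<close>

lemma nullity_remove:
  assumes "matroid n \<Delta>" "finite S"
  shows "nullity \<Delta> S \<le> Suc (nullity \<Delta> (S - {i}))"
proof -
  obtain F where F: "F \<in> facets \<Delta>" "nullity \<Delta> (S - {i}) = card (S - {i} - F)"
    using nullity_obtain[OF assms(1)] .
  have "card (S - F) \<le> card (insert i (S - {i} - F))"
    using assms(2) by (intro card_mono) auto
  also have "\<dots> \<le> Suc (card (S - {i} - F))"
    by (rule card_insert_le_m1) auto
  finally show ?thesis using F nullity_le[OF assms(1) F(1), of S] by simp
qed

text \<open>The greedy algorithm: build the facet from the innermost set of the chain outwards.\<close>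

lemma matroid_greedy:
  fixes U :: "nat \<Rightarrow> nat set"
  assumes M: "matroid n \<Delta>" and U: "mono U"
  shows "\<exists>J\<in>\<Delta>. J \<subseteq> U k \<and> (\<forall>j\<le>k. \<forall>G\<in>\<Delta>. G \<subseteq> U j \<longrightarrow> card G \<le> card (J \<inter> U j))"
proof (induction k)
  case 0
  have "{} \<in> \<Delta>" using M unfolding matroid_def by blast
  then obtain J where J: "J \<in> \<Delta>" "J \<subseteq> U 0" "\<And>G. G \<in> \<Delta> \<Longrightarrow> G \<subseteq> U 0 \<Longrightarrow> card G \<le> card J"
    using matroid_extend[OF M, of "{}" "U 0"] by (metis empty_subsetI)
  have "J \<inter> U 0 = J" using J by blast
  then show ?case using J by auto
next
  case (Suc k)
  then obtain J where J: "J \<in> \<Delta>" "J \<subseteq> U k"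
    "\<And>j G. j \<le> k \<Longrightarrow> G \<in> \<Delta> \<Longrightarrow> G \<subseteq> U j \<Longrightarrow> card G \<le> card (J \<inter> U j)" by blast
  have "J \<subseteq> U (Suc k)" using J(2) monoD[OF U, of k "Suc k"] by auto
  then obtain J' where J': "J' \<in> \<Delta>" "J \<subseteq> J'" "J' \<subseteq> U (Suc k)"
    "\<And>G. G \<in> \<Delta> \<Longrightarrow> G \<subseteq> U (Suc k) \<Longrightarrow> card G \<le> card J'"
    using matroid_extend[OF M J(1)] by metis
  have fin: "finite J'" using J'(1) matroid_subset[OF M] finite_subset by blast
  have "card G \<le> card (J' \<inter> U j)" if "j \<le> Suc k" "G \<in> \<Delta>" "G \<subseteq> U j" for j G
  proof (cases "j = Suc k")
    case True
    then show ?thesis using J' that by (metis inf.absorb1)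
  next
    case False
    \<comment> \<open>Optimality on the earlier sets survives the extension, because
      \<open>J'\<close> contains \<open>J\<close>.\<close>
    then have "card G \<le> card (J \<inter> U j)" using that J(3) by simp
    also have "\<dots> \<le> card (J' \<inter> U j)" using fin J'(2) by (intro card_mono) auto
    finally show ?thesis .
  qed
  then show ?case using J' by blast
qed

text \<open>Read backwards, the chain increases, and the greedy set has a largest possible trace on
  every layer, hence a smallest complement in it. This is what makes the minimum of a sum of
  cardinalities equal to the sum of the minima.\<close>

lemma facet_optimal_for_chain:
  fixes S :: "nat \<Rightarrow> nat set"
  assumes M: "matroid n \<Delta>" and S: "antimono S" "\<And>j. S j \<subseteq> {1..n}"
  obtains F where "F \<in> facets \<Delta>" "\<And>j. j \<le> t \<Longrightarrow> card (S j - F) = nullity \<Delta> (S j)"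
proof -
  \<comment> \<open>The chain is reversed, with the innermost layer \<open>S t\<close> at index 0.
    The ground set at index \<open>Suc t\<close> forces the greedy set to have maximal cardinality
    in \<open>\<Delta>\<close>, so that it is a facet.\<close>
  define U where "U j = (if j > t then {1..n} else S (t - j))" for j
  have U: "mono U"
  proof (rule monoI)
    fix i j :: nat assume "i \<le> j"
    then show "U i \<subseteq> U j"
      unfolding U_def using antimonoD[OF S(1), of "t - j" "t - i"] S(2) by auto
  qed
  obtain F where F: "F \<in> \<Delta>" "F \<subseteq> U (Suc t)"
    "\<And>j G. j \<le> Suc t \<Longrightarrow> G \<in> \<Delta> \<Longrightarrow> G \<subseteq> U j \<Longrightarrow> card G \<le> card (F \<inter> U j)"
    using matroid_greedy[OF M U, of "Suc t"] by blast
  have fin: "finite G" if "G \<in> \<Delta>" for G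
    using that matroid_subset[OF M] finite_subset by blast
  have "card G \<le> card F" if "G \<in> \<Delta>" for G
    using F(3)[of "Suc t" G] that matroid_subset[OF M that] matroid_subset[OF M F(1)]
    by (simp add: U_def Int_absorb2)
  then have facet: "F \<in> facets \<Delta>"
    unfolding facets_def using F(1) card_seteq[OF fin] by blast
  have "card (S j - F) = nullity \<Delta> (S j)" if j: "j \<le> t" for j
  proof (rule antisym)
    obtain G where G: "G \<in> facets \<Delta>" "nullity \<Delta> (S j) = card (S j - G)"
      using nullity_obtain[OF M] .
    have "\<not> t < t - j" by simp
    then have "U (t - j) = S j" using j by (simp add: U_def)
    \<comment> \<open>The trace of the competing facet is independent, so the greedy bound applies
      to it; passing to complements in \<open>S j\<close> reverses the inequality.\<close>
    moreover have "G \<inter> S j \<in> \<Delta>" using G(1) matroid_down[OF M, of G] by (auto simp: facets_def)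
    ultimately have "card (S j \<inter> G) \<le> card (S j \<inter> F)"
      using F(3)[of "t - j" "G \<inter> S j"] by (simp add: Int_commute)
    moreover have "finite (S j)" using S(2) finite_subset by blast
    ultimately show "card (S j - F) \<le> nullity \<Delta> (S j)"
      unfolding G(2) by (simp add: card_Diff_subset_Int)
  qed (rule nullity_le[OF M facet])
  then show ?thesis using that facet by blast
qed

text \<open>The nullity drops exactly when \<open>i\<close> lies in a circuit inside the set, and
  such a circuit persists in larger sets. The proof avoids circuits: one facet is optimal for
  \<open>S - {i}\<close>, \<open>S\<close> and \<open>S'\<close> at once, the drop forces
  \<open>i\<close> outside it, and the same facet then shows the drop for \<open>S'\<close>.\<close>

lemma nullity_remove_mono:
  assumes M: "matroid n \<Delta>" and S: "S \<subseteq> S'" "S' \<subseteq> {1..n}" and i: "i \<in> S"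
    and less: "nullity \<Delta> (S - {i}) < nullity \<Delta> S"
  shows "nullity \<Delta> (S' - {i}) < nullity \<Delta> S'"
proof -
  \<comment> \<open>The three sets as a decreasing sequence, constant from index 2 on.\<close>
  define C where "C j = (if j = 0 then S' else if j = 1 then S else S - {i})" for j :: nat
  have "antimono C" using S unfolding antimono_def C_def by auto
  moreover have "C j \<subseteq> {1..n}" for j using S unfolding C_def by auto
  ultimately obtain F where F: "F \<in> facets \<Delta>" "\<And>j. j \<le> 2 \<Longrightarrow> card (C j - F) = nullity \<Delta> (C j)"
    using facet_optimal_for_chain[OF M] by metis
  have C: "C 0 = S'" "C 1 = S" "C 2 = S - {i}" by (simp_all add: C_def)
  have "i \<notin> F"
  proof
    assume "i \<in> F"
    then have "S - {i} - F = S - F" by blast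
    then show False using F(2)[of 1] F(2)[of 2] less unfolding C by simp
  qed
  have "finite S'" using S finite_subset by blast
  have "nullity \<Delta> (S' - {i}) \<le> card (S' - {i} - F)" by (rule nullity_le[OF M F(1)])
  also have "\<dots> < card (S' - F)"
    using \<open>finite S'\<close> \<open>i \<notin> F\<close> i S by (intro psubset_card_mono) auto
  also have "\<dots> = nullity \<Delta> S'" using F(2)[of 0] C by simp
  finally show ?thesis .
qed

section \<open>Exponent vectors as sums of layers\<close>

definition indicator_exp :: "nat set \<Rightarrow> nat \<Rightarrow>\<^sub>0 nat" where
  "indicator_exp S = (\<Sum>i\<in>S. Poly_Mapping.single i 1)"

lemma lookup_indicator_exp:
  "finite S \<Longrightarrow> Poly_Mapping.lookup (indicator_exp S) i = of_bool (i \<in> S)"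
  unfolding indicator_exp_def by (simp add: lookup_sum lookup_single when_def)

text \<open>One inequality for each associated prime. Entries outside \<open>{1..n}\<close> are left
  free; \<open>monomial_ideal\<close> restricts the support through the carrier.\<close>

definition symbolic_exps :: "nat \<Rightarrow> nat set set \<Rightarrow> nat \<Rightarrow> (nat \<Rightarrow>\<^sub>0 nat) set" where
  "symbolic_exps n \<Delta> l = {a. \<forall>F\<in>facets \<Delta>. l \<le> (\<Sum>i\<in>{1..n} - F. Poly_Mapping.lookup a i)}"

text \<open>The weight outside a facet \<open>F\<close> is the sum of the numbers
  \<open>card (S j - F)\<close>. Each term is at least the nullity of its layer, and one facet
  attains equality in all of them.\<close>

lemma symbolic_exps_layers:
  fixes S :: "nat \<Rightarrow> nat set"
  assumes M: "matroid n \<Delta>" and S: "antimono S" "\<And>j. S j \<subseteq> {1..n}"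
  shows "(\<Sum>j<t. indicator_exp (S j)) \<in> symbolic_exps n \<Delta> l \<longleftrightarrow> l \<le> (\<Sum>j<t. nullity \<Delta> (S j))"
proof -
  have fin: "finite (S j)" for j using S(2) finite_subset by blast
  have weight: "(\<Sum>i\<in>{1..n} - F. Poly_Mapping.lookup (\<Sum>j<t. indicator_exp (S j)) i) = (\<Sum>j<t. card (S j - F))" for F
  proof -
    have "(\<Sum>i\<in>{1..n} - F. Poly_Mapping.lookup (\<Sum>j<t. indicator_exp (S j)) i)
        = (\<Sum>j<t. \<Sum>i\<in>{1..n} - F. of_bool (i \<in> S j))"
      by (subst sum.swap) (simp add: lookup_sum lookup_indicator_exp fin)
    also have "\<dots> = (\<Sum>j<t. card (({1..n} - F) \<inter> S j))"
      by (intro sum.cong refl) (simp add: of_bool_def sum.If_cases)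
    also have "\<dots> = (\<Sum>j<t. card (S j - F))"
      using S(2) by (intro sum.cong refl arg_cong[of _ _ card]) auto
    finally show ?thesis .
  qed
  obtain F where F: "F \<in> facets \<Delta>" "\<And>j. j \<le> t \<Longrightarrow> card (S j - F) = nullity \<Delta> (S j)"
    using facet_optimal_for_chain[OF M S] by blast
  have "(\<Sum>j<t. card (S j - F)) = (\<Sum>j<t. nullity \<Delta> (S j))"
    using F by (intro sum.cong) auto
  moreover have "l \<le> (\<Sum>j<t. card (S j - G))" if "G \<in> facets \<Delta>" "l \<le> (\<Sum>j<t. nullity \<Delta> (S j))" for G
    using that(2) by (rule le_trans) (intro sum_mono nullity_le[OF M that(1)])
  ultimately have "(\<forall>G\<in>facets \<Delta>. l \<le> (\<Sum>j<t. card (S j - G))) \<longleftrightarrow> l \<le> (\<Sum>j<t. nullity \<Delta> (S j))"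
    using F(1) by auto
  then show ?thesis
    unfolding symbolic_exps_def weight mem_Collect_eq .
qed

text \<open>Lowering the exponent of \<open>i\<close> changes the sum of nullities by the drop in
  the innermost layer containing \<open>i\<close>. Minimality forces a drop there, and
  \<open>nullity_remove_mono\<close> carries it to all outer layers.\<close>

lemma symbolic_exps_minimal_layers:
  fixes S :: "nat \<Rightarrow> nat set"
  assumes M: "matroid n \<Delta>" and S: "antimono S" "\<And>j. S j \<subseteq> {1..n}" "\<And>j. t \<le> j \<Longrightarrow> S j = {}"
    and l: "1 \<le> l" and a: "a = (\<Sum>j<t. indicator_exp (S j))"
  shows "a \<in> symbolic_exps n \<Delta> l \<and> (\<forall>i a'. a = a' + Poly_Mapping.single i 1 \<longrightarrow> a' \<notin> symbolic_exps n \<Delta> l) \<longleftrightarrow>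
     (\<Sum>j<t. nullity \<Delta> (S j)) = l \<and> (\<forall>j<t. \<forall>i\<in>S j. nullity \<Delta> (S j - {i}) < nullity \<Delta> (S j))"
    (is "?L \<longleftrightarrow> ?R")
proof -
  have fin: "finite (S j)" for j using S(2) finite_subset by blast
  have lookup_a: "Poly_Mapping.lookup a i = (\<Sum>j<t. of_bool (i \<in> S j))" for i
    by (simp add: a lookup_sum lookup_indicator_exp fin)
  \<comment> \<open>Here \<open>k\<close> is the innermost layer containing \<open>i\<close>. The
    lowered sum is compared with \<open>l\<close> by adding to both sides, which avoids truncated
    subtraction.\<close>
  have remove: "\<exists>k. j \<le> k \<and> k < t \<and> i \<in> S k \<and>
      (\<forall>a'. a = a' + Poly_Mapping.single i 1 \<longrightarrow>
        (a' \<in> symbolic_exps n \<Delta> l \<longleftrightarrow>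
         l + nullity \<Delta> (S k) \<le> (\<Sum>j<t. nullity \<Delta> (S j)) + nullity \<Delta> (S k - {i})))"
    if "i \<in> S j" for i j
  proof -
    let ?K = "{k. i \<in> S k}"
    have K: "?K \<subseteq> {..<t}" using S(3) by (metis (no_types, lifting) empty_iff lessThan_iff mem_Collect_eq not_le subsetI)
    then have finK: "finite ?K" using finite_subset by blast
    define k where "k = Max ?K"
    have k: "i \<in> S k" "j \<le> k" using Max_in[OF finK] Max_ge[OF finK] that unfolding k_def by auto
    have above: "i \<notin> S m" if "k < m" for m
      using Max_ge[OF finK, of m] that unfolding k_def by auto
    have kt: "k < t" using k K by auto
    \<comment> \<open>The sequence stays decreasing, because no layer after \<open>k\<close>
      contains \<open>i\<close>.\<close>
    define S' where "S' = S(k := S k - {i})"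
    have S': "antimono S'" "\<And>j. S' j \<subseteq> {1..n}"
    proof -
      show "antimono S'"
      proof (rule antimonoI)
        fix x y :: nat assume "x \<le> y"
        then show "S' y \<subseteq> S' x"
          using antimonoD[OF S(1), of x y] above[of y] unfolding S'_def by auto
      qed
      show "S' j \<subseteq> {1..n}" for j using S(2) unfolding S'_def by auto
    qed
    have fin': "finite (S' j)" for j using S'(2) finite_subset by blast
    have "indicator_exp (S k) = indicator_exp (S k - {i}) + Poly_Mapping.single i 1"
      unfolding indicator_exp_def using sum.remove[OF fin k(1)] by (simp add: add.commute)
    then have eq: "a = (\<Sum>j<t. indicator_exp (S' j)) + Poly_Mapping.single i 1"
      using kt unfolding a S'_def
      by (simp add: sum.remove[of "{..<t}" k] add.assoc add.commute add.left_commute)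
    have sums: "(\<Sum>j<t. nullity \<Delta> (S' j)) + nullity \<Delta> (S k)
        = (\<Sum>j<t. nullity \<Delta> (S j)) + nullity \<Delta> (S k - {i})"
      using kt unfolding S'_def by (simp add: sum.remove[of "{..<t}" k])
    have "a' \<in> symbolic_exps n \<Delta> l \<longleftrightarrow>
         l + nullity \<Delta> (S k) \<le> (\<Sum>j<t. nullity \<Delta> (S j)) + nullity \<Delta> (S k - {i})"
      if "a = a' + Poly_Mapping.single i 1" for a'
    proof -
      have "a' = (\<Sum>j<t. indicator_exp (S' j))" using that eq by simp
      then show ?thesis
        using symbolic_exps_layers[OF M S', of t l] sums by (metis add_le_cancel_right)
    qed
    then show ?thesis using k kt by blast
  qed
  have split: "\<exists>a'. a = a' + Poly_Mapping.single i 1" if "i \<in> S j" "j < t" for i j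
  proof -
    have "Poly_Mapping.lookup a i \<noteq> 0" unfolding lookup_a using that by auto
    then have "a = (a - Poly_Mapping.single i 1) + Poly_Mapping.single i 1"
      by (intro poly_mapping_eqI)
        (auto simp: lookup_add minus_poly_mapping.rep_eq lookup_single when_def)
    then show ?thesis by blast
  qed
  show ?thesis
  proof
    assume L: ?L
    then have ge: "l \<le> (\<Sum>j<t. nullity \<Delta> (S j))"
      using symbolic_exps_layers[OF M S(1,2)] a by blast
    \<comment> \<open>Since \<open>l\<close> is positive, some layer is nonempty, so there is an
      exponent to lower.\<close>
    have "\<exists>j<t. S j \<noteq> {}"
    proof (rule ccontr)
      assume "\<not> ?thesis"
      then show False using ge l nullity_empty[OF M] by simp
    qed
    then obtain j i where "j < t" "i \<in> S j" by blast
    moreover have less: "\<exists>k\<ge>j. k < t \<and> i \<in> S k \<and>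
        (\<Sum>j<t. nullity \<Delta> (S j)) + nullity \<Delta> (S k - {i}) < l + nullity \<Delta> (S k)"
      if ij: "j < t" "i \<in> S j" for i j
    proof -
      obtain k where k: "j \<le> k" "k < t" "i \<in> S k"
        "\<And>a'. a = a' + Poly_Mapping.single i 1 \<Longrightarrow>
        (a' \<in> symbolic_exps n \<Delta> l \<longleftrightarrow>
         l + nullity \<Delta> (S k) \<le> (\<Sum>j<t. nullity \<Delta> (S j)) + nullity \<Delta> (S k - {i}))"
        using remove[OF ij(2)] by blast
      obtain a' where a': "a = a' + Poly_Mapping.single i 1" using split[OF ij(2,1)] by blast
      then have "a' \<notin> symbolic_exps n \<Delta> l" using L by blast
      then show ?thesis using k(1-3) k(4)[OF a'] by (metis not_le)
    qed
    ultimately obtain k where k: "(\<Sum>j<t. nullity \<Delta> (S j)) + nullity \<Delta> (S k - {i}) < l + nullity \<Delta> (S k)"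
      by blast
    \<comment> \<open>The sum is at least \<open>l\<close>, while a decrease by at most one brings
      it below \<open>l\<close>.\<close>
    have eq: "(\<Sum>j<t. nullity \<Delta> (S j)) = l"
      using ge k nullity_remove[OF M fin, of k i] by linarith
    \<comment> \<open>Now that the sum is exactly \<open>l\<close>, falling below \<open>l\<close>
      means a strict drop in layer \<open>k\<close>, and \<open>S k\<close> is contained in
      \<open>S j\<close>.\<close>
    have "nullity \<Delta> (S j - {i}) < nullity \<Delta> (S j)" if ij: "j < t" "i \<in> S j" for i j
    proof -
      obtain k where k: "j \<le> k" "i \<in> S k" "nullity \<Delta> (S k - {i}) < nullity \<Delta> (S k)"
        using less[OF ij] unfolding eq by auto
      show ?thesis
        using nullity_remove_mono[OF M antimonoD[OF S(1) k(1)] S(2) k(2,3)] .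
    qed
    then show ?R using eq by blast
  next
    assume R: ?R
    then have "a \<in> symbolic_exps n \<Delta> l"
      using symbolic_exps_layers[OF M S(1,2)] a by blast
    moreover have "a' \<notin> symbolic_exps n \<Delta> l" if "a = a' + Poly_Mapping.single i 1" for i a'
    proof -
      have "Poly_Mapping.lookup a i \<noteq> 0" unfolding that by (simp add: lookup_add)
      then obtain j where "i \<in> S j" by (auto simp: lookup_a split: if_splits)
      then obtain k where k: "k < t" "i \<in> S k" "\<And>a'. a = a' + Poly_Mapping.single i 1 \<Longrightarrow>
        (a' \<in> symbolic_exps n \<Delta> l \<longleftrightarrow>
         l + nullity \<Delta> (S k) \<le> (\<Sum>j<t. nullity \<Delta> (S j)) + nullity \<Delta> (S k - {i}))"
        using remove[of i j] by blast
      note k(3)[OF that]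
      moreover have "nullity \<Delta> (S k - {i}) < nullity \<Delta> (S k)" using R k(1,2) by blast
      ultimately show ?thesis using R by linarith
    qed
    ultimately show ?L by blast
  qed
qed

section \<open>Monomial ideals\<close>

definition up_closed :: "(nat \<Rightarrow>\<^sub>0 nat) set \<Rightarrow> bool" where
  "up_closed U \<longleftrightarrow> (\<forall>a\<in>U. \<forall>b. a + b \<in> U)"

text \<open>For up-closed \<open>U\<close> this is the ideal spanned by the monomials with exponents
  in \<open>U\<close>, so questions about ideals become questions about sets of exponents.\<close>

definition monomial_ideal :: "nat \<Rightarrow> (nat \<Rightarrow>\<^sub>0 nat) set \<Rightarrow> ('k::field) mpoly set" where
  "monomial_ideal n U = {p \<in> carrier (mpoly_ring n). Poly_Mapping.keys p \<subseteq> U}"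

lemma keys_add_exp: "Poly_Mapping.keys (a + b) = Poly_Mapping.keys a \<union> Poly_Mapping.keys (b :: nat \<Rightarrow>\<^sub>0 nat)"
  by (auto simp: in_keys_iff lookup_add)

section \<open>The polynomial ring and its ideals\<close>

lemma mpoly_ring_simps [simp]:
  "a \<otimes>\<^bsub>mpoly_ring n\<^esub> b = a * b" "\<one>\<^bsub>mpoly_ring n\<^esub> = 1" "\<zero>\<^bsub>mpoly_ring n\<^esub> = 0"
  "a \<oplus>\<^bsub>mpoly_ring n\<^esub> b = a + b"
  by (simp_all add: mpoly_ring_def)

lemma mpoly_carrier_iff:
  "p \<in> carrier (mpoly_ring n) \<longleftrightarrow> (\<forall>a\<in>Poly_Mapping.keys p. Poly_Mapping.keys a \<subseteq> {1..n})"
  by (simp add: mpoly_ring_def)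

lemma keys_add_subset:
  fixes p q :: "('k::field) mpoly"
  shows "Poly_Mapping.keys p \<subseteq> U \<Longrightarrow> Poly_Mapping.keys q \<subseteq> U \<Longrightarrow> Poly_Mapping.keys (p + q) \<subseteq> U"
  using keys_add[of p q] by blast

lemma keys_uminus: "Poly_Mapping.keys (- p) = Poly_Mapping.keys (p :: ('k::field) mpoly)"
  by (auto simp: in_keys_iff)

lemma keys_mult_subset:
  fixes p q :: "('k::field) mpoly"
  assumes "\<And>a b. a \<in> Poly_Mapping.keys p \<Longrightarrow> b \<in> Poly_Mapping.keys q \<Longrightarrow> a + b \<in> U"
  shows "Poly_Mapping.keys (p * q) \<subseteq> U"
  using keys_mult[of p q] assms by blast

lemma mpoly_carrier_add:
  "p \<in> carrier (mpoly_ring n) \<Longrightarrow> q \<in> carrier (mpoly_ring n) \<Longrightarrow> p + q \<in> carrier (mpoly_ring n)"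
  unfolding mpoly_carrier_iff using keys_add[of p q] by blast

lemma mpoly_carrier_uminus: "p \<in> carrier (mpoly_ring n) \<Longrightarrow> - p \<in> carrier (mpoly_ring n)"
  by (simp add: mpoly_carrier_iff keys_uminus)

lemma mpoly_carrier_mult:
  assumes "p \<in> carrier (mpoly_ring n)" "q \<in> carrier (mpoly_ring n)"
  shows "p * q \<in> carrier (mpoly_ring n)"
proof -
  have "Poly_Mapping.keys (p * q) \<subseteq> {a. Poly_Mapping.keys a \<subseteq> {1..n}}"
  proof (rule keys_mult_subset)
    fix a b assume "a \<in> Poly_Mapping.keys p" "b \<in> Poly_Mapping.keys q"
    then have "Poly_Mapping.keys a \<subseteq> {1..n}" "Poly_Mapping.keys b \<subseteq> {1..n}"
      using assms unfolding mpoly_carrier_iff by blast+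
    then show "a + b \<in> {a. Poly_Mapping.keys a \<subseteq> {1..n}}" by (simp add: keys_add_exp)
  qed
  then show ?thesis unfolding mpoly_carrier_iff by blast
qed

lemma mpoly_carrier_zero: "0 \<in> carrier (mpoly_ring n)"
  by (simp add: mpoly_carrier_iff)

lemma mpoly_cring: "cring (mpoly_ring n :: ('k::field) mpoly ring)"
proof (rule cringI)
  show "abelian_group (mpoly_ring n :: 'k mpoly ring)"
  proof (rule abelian_groupI)
    fix x :: "'k mpoly" assume "x \<in> carrier (mpoly_ring n)"
    then show "\<exists>y\<in>carrier (mpoly_ring n). y \<oplus>\<^bsub>mpoly_ring n\<^esub> x = \<zero>\<^bsub>mpoly_ring n\<^esub>"
      by (intro bexI[of _ "- x"]) (simp_all add: mpoly_carrier_uminus)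
  qed (simp_all add: mpoly_carrier_add mpoly_carrier_zero algebra_simps)
  show "comm_monoid (mpoly_ring n :: 'k mpoly ring)"
  proof (rule comm_monoidI)
    show "\<one>\<^bsub>mpoly_ring n\<^esub> \<in> carrier (mpoly_ring n :: 'k mpoly ring)" by (simp add: mpoly_carrier_iff)
  qed (simp_all add: mpoly_carrier_mult ac_simps)
qed (simp only: mpoly_ring_simps distrib_right)

lemma mpoly_ring: "ring (mpoly_ring n :: ('k::field) mpoly ring)"
  using mpoly_cring cring.axioms(1) by blast

lemma mpoly_a_inv:
  assumes "(x :: ('k::field) mpoly) \<in> carrier (mpoly_ring n)"
  shows "\<ominus>\<^bsub>mpoly_ring n\<^esub> x = - x"
proof -
  interpret cring "mpoly_ring n :: 'k mpoly ring" by (rule mpoly_cring)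
  show ?thesis
    using minus_equality[of "- x" x] assms by (simp add: mpoly_carrier_uminus)
qed

lemma ideal_add:
  "ideal J (mpoly_ring n) \<Longrightarrow> p \<in> J \<Longrightarrow> q \<in> J \<Longrightarrow> p + q \<in> J"
  using additive_subgroup.a_closed[OF ideal.axioms(1), of J "mpoly_ring n" p q] by simp

lemma ideal_zero: "ideal J (mpoly_ring n) \<Longrightarrow> 0 \<in> J"
  using additive_subgroup.zero_closed[OF ideal.axioms(1), of J "mpoly_ring n"] by simp

lemma mpoly_idealI:
  fixes J :: "('k::field) mpoly set"
  assumes J: "J \<subseteq> carrier (mpoly_ring n)" "0 \<in> J" "\<And>p q. p \<in> J \<Longrightarrow> q \<in> J \<Longrightarrow> p + q \<in> J"
    and mult: "\<And>p q. p \<in> J \<Longrightarrow> q \<in> carrier (mpoly_ring n) \<Longrightarrow> p * q \<in> J"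
  shows "ideal J (mpoly_ring n)"
proof (rule idealI)
  interpret cring "mpoly_ring n :: 'k mpoly ring" by (rule mpoly_cring)
  show "ring (mpoly_ring n :: 'k mpoly ring)" by (rule mpoly_ring)
  show "subgroup J (add_monoid (mpoly_ring n))"
  proof (rule add.subgroupI)
    fix p assume p: "p \<in> J"
    \<comment> \<open>Closure under negation follows from multiplication by the constant -1.\<close>
    then have "p * (- 1) \<in> J"
      using mult[of p "- 1"] by (simp add: mpoly_carrier_iff keys_uminus)
    then show "\<ominus>\<^bsub>mpoly_ring n\<^esub> p \<in> J" using p J(1) by (simp add: mpoly_a_inv subsetD)
  qed (use J in auto)
  fix p q :: "'k mpoly" assume "p \<in> J" "q \<in> carrier (mpoly_ring n)"
  then have "p * q \<in> J" by (rule mult)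
  then show "p \<otimes>\<^bsub>mpoly_ring n\<^esub> q \<in> J" "q \<otimes>\<^bsub>mpoly_ring n\<^esub> p \<in> J"
    by (simp_all only: mpoly_ring_simps mult.commute[of q p])
qed

lemma monomial_ideal_ideal:
  assumes "up_closed U"
  shows "ideal (monomial_ideal n U :: ('k::field) mpoly set) (mpoly_ring n)"
proof (rule mpoly_idealI)
  fix p q :: "'k mpoly" assume p: "p \<in> monomial_ideal n U" and q: "q \<in> carrier (mpoly_ring n)"
  have "Poly_Mapping.keys (p * q) \<subseteq> U"
    using p assms by (intro keys_mult_subset) (auto simp: monomial_ideal_def up_closed_def)
  then show "p * q \<in> monomial_ideal n U"
    using p q by (simp add: monomial_ideal_def mpoly_carrier_mult)
next
  fix p q :: "'k mpoly" assume "p \<in> monomial_ideal n U" "q \<in> monomial_ideal n U"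
  then show "p + q \<in> monomial_ideal n U"
    by (simp add: monomial_ideal_def mpoly_carrier_add keys_add_subset)
qed (auto simp: monomial_ideal_def mpoly_carrier_zero)

lemma single_in_monomial_ideal:
  "Poly_Mapping.single a (1::'k::field) \<in> monomial_ideal n U \<longleftrightarrow> a \<in> U \<and> Poly_Mapping.keys a \<subseteq> {1..n}"
  by (auto simp: monomial_ideal_def mpoly_carrier_iff)

lemma poly_mapping_sum_singles:
  "p = (\<Sum>a\<in>Poly_Mapping.keys p. Poly_Mapping.single a (Poly_Mapping.lookup p a))"
  by (rule poly_mapping_eqI) (simp add: lookup_sum lookup_single when_def in_keys_iff)

lemma ideal_sum:
  assumes "ideal J (mpoly_ring n)" "\<And>a. a \<in> A \<Longrightarrow> f a \<in> J"
  shows "sum f A \<in> J"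
  using assms(2)
proof (induction A rule: infinite_finite_induct)
  case (insert a A)
  then show ?case using ideal_add[OF assms(1), of "f a" "sum f A"] by auto
qed (simp_all add: ideal_zero[OF assms(1)])

text \<open>A polynomial is the sum of its terms, and each term is a monomial times a constant
  polynomial.\<close>

lemma monomial_ideal_subset:
  assumes J: "ideal J (mpoly_ring n)"
    and gens: "\<And>a. a \<in> U \<Longrightarrow> Poly_Mapping.keys a \<subseteq> {1..n} \<Longrightarrow> Poly_Mapping.single a (1::'k::field) \<in> J"
  shows "monomial_ideal n U \<subseteq> J"
proof
  fix p :: "'k mpoly" assume p: "p \<in> monomial_ideal n U"
  have "Poly_Mapping.single a (Poly_Mapping.lookup p a) \<in> J" if a: "a \<in> Poly_Mapping.keys p" for a
  proof -
    have "Poly_Mapping.single a (1::'k) \<in> J"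
      using a p gens by (auto simp: monomial_ideal_def mpoly_carrier_iff)
    moreover have "Poly_Mapping.single 0 (Poly_Mapping.lookup p a) \<in> carrier (mpoly_ring n)"
      by (simp add: mpoly_carrier_iff)
    ultimately have "Poly_Mapping.single a 1 * Poly_Mapping.single 0 (Poly_Mapping.lookup p a) \<in> J"
      using ideal.I_r_closed[OF J] by fastforce
    then show ?thesis by (simp add: mult_single)
  qed
  then show "p \<in> J" by (subst poly_mapping_sum_singles) (rule ideal_sum[OF J])
qed

definition up_closure :: "(nat \<Rightarrow>\<^sub>0 nat) set \<Rightarrow> (nat \<Rightarrow>\<^sub>0 nat) set" where
  "up_closure A = {a + b |a b. a \<in> A}"

lemma up_closed_up_closure: "up_closed (up_closure A)"
proof -
  have "a + b + c \<in> up_closure A" if "a \<in> A" for a b c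
    unfolding up_closure_def add.assoc using that by blast
  then show ?thesis unfolding up_closed_def up_closure_def by auto
qed

lemma subset_up_closure: "A \<subseteq> up_closure A"
proof
  fix a assume "a \<in> A"
  then have "a + 0 \<in> up_closure A" unfolding up_closure_def by blast
  then show "a \<in> up_closure A" by simp
qed

text \<open>The right-hand side is an ideal containing the generators; conversely, each of its
  monomials is a generator times another monomial in the same variables.\<close>

lemma Idl_monomials:
  assumes A: "\<And>a. a \<in> A \<Longrightarrow> Poly_Mapping.keys a \<subseteq> {1..n}"
  shows "Idl\<^bsub>mpoly_ring n\<^esub> ((\<lambda>a. Poly_Mapping.single a (1::'k::field)) ` A) = monomial_ideal n (up_closure A)"
    (is "Idl\<^bsub>_\<^esub> ?G = ?M")
proof
  interpret cring "mpoly_ring n :: 'k mpoly ring" by (rule mpoly_cring)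
  have G: "?G \<subseteq> carrier (mpoly_ring n)" using A by (auto simp: mpoly_carrier_iff)
  have "?G \<subseteq> ?M" using A subset_up_closure[of A] by (auto simp: single_in_monomial_ideal)
  then show "Idl\<^bsub>mpoly_ring n\<^esub> ?G \<subseteq> ?M"
    by (rule genideal_minimal[OF monomial_ideal_ideal[OF up_closed_up_closure]])
  have J: "ideal (Idl\<^bsub>mpoly_ring n\<^esub> ?G) (mpoly_ring n)" by (rule genideal_ideal[OF G])
  show "?M \<subseteq> Idl\<^bsub>mpoly_ring n\<^esub> ?G"
  proof (rule monomial_ideal_subset[OF J])
    fix c assume "c \<in> up_closure A" and c: "Poly_Mapping.keys c \<subseteq> {1..n}"
    then obtain a b where ab: "c = a + b" "a \<in> A" by (auto simp: up_closure_def)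
    have "Poly_Mapping.single a (1::'k) \<in> Idl\<^bsub>mpoly_ring n\<^esub> ?G" using genideal_self[OF G] ab by blast
    moreover have "Poly_Mapping.single b (1::'k) \<in> carrier (mpoly_ring n)"
      using c ab by (simp add: mpoly_carrier_iff keys_add_exp)
    ultimately show "Poly_Mapping.single c (1::'k) \<in> Idl\<^bsub>mpoly_ring n\<^esub> ?G"
      using ideal.I_r_closed[OF J] ab by (fastforce simp: mult_single)
  qed
qed

section \<open>Minimal generators\<close>

text \<open>Minimality under divisibility, tested only by lowering one exponent by one. For
  up-closed \<open>U\<close> this excludes every proper divisor, and it matches the form of the
  layer criterion.\<close>

definition minimal_exps :: "nat \<Rightarrow> (nat \<Rightarrow>\<^sub>0 nat) set \<Rightarrow> (nat \<Rightarrow>\<^sub>0 nat) set" where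
  "minimal_exps n U = {a \<in> U. Poly_Mapping.keys a \<subseteq> {1..n} \<and> (\<forall>i a'. a = a' + Poly_Mapping.single i 1 \<longrightarrow> a' \<notin> U)}"

lemma exp_split:
  assumes "i \<in> Poly_Mapping.keys (a :: nat \<Rightarrow>\<^sub>0 nat)"
  shows "a = (a - Poly_Mapping.single i 1) + Poly_Mapping.single i 1"
  using assms by (intro poly_mapping_eqI)
    (auto simp: lookup_add minus_poly_mapping.rep_eq lookup_single when_def in_keys_iff)

text \<open>If \<open>b\<close> were nonzero, one of its entries could be lowered and the sum with
  \<open>a\<close> would still lie in \<open>U\<close>.\<close>

lemma minimal_exps_divisor:
  assumes U: "up_closed U" and ab: "a + b \<in> minimal_exps n U" "a \<in> U"
  shows "b = 0"
proof (rule ccontr)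
  assume "b \<noteq> 0"
  then obtain i where "i \<in> Poly_Mapping.keys b" by fastforce
  then have "a + b = (a + (b - Poly_Mapping.single i 1)) + Poly_Mapping.single i 1"
    using exp_split[of i b] by (simp add: add.assoc)
  moreover have "a + (b - Poly_Mapping.single i 1) \<in> U" using U ab(2) by (auto simp: up_closed_def)
  ultimately show False using ab(1) by (auto simp: minimal_exps_def)
qed

text \<open>Descent on the total degree: an element that is not minimal can be lowered inside
  \<open>U\<close>.\<close>

lemma minimal_exps_below:
  assumes "a \<in> U" "Poly_Mapping.keys a \<subseteq> {1..n}"
  shows "\<exists>b\<in>minimal_exps n U. \<exists>c. a = b + c"
  using assms
proof (induction "\<Sum>i\<in>{1..n}. Poly_Mapping.lookup a i" arbitrary: a rule: less_induct)
  case less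
  show ?case
  proof (cases "a \<in> minimal_exps n U")
    case True
    then show ?thesis by (intro bexI[of _ a] exI[of _ 0]) auto
  next
    case False
    then obtain i a' where a': "a = a' + Poly_Mapping.single i 1" "a' \<in> U"
      using less.prems by (auto simp: minimal_exps_def)
    have keys: "Poly_Mapping.keys a' \<subseteq> {1..n}" "i \<in> {1..n}"
      using less.prems(2) by (auto simp: a' keys_add_exp)
    have "(\<Sum>i\<in>{1..n}. Poly_Mapping.lookup a' i) < (\<Sum>i\<in>{1..n}. Poly_Mapping.lookup a i)"
      unfolding a'(1) lookup_add sum.distrib using keys(2)
      by (simp add: lookup_single when_def)
    then obtain b c where "b \<in> minimal_exps n U" "a' = b + c"
      using less.hyps a'(2) keys(1) by blast
    then show ?thesis using a'(1) by (auto simp: add.assoc)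
  qed
qed

lemma up_closure_minimal_exps:
  assumes "up_closed U"
  shows "monomial_ideal n (up_closure (minimal_exps n U)) = monomial_ideal n U"
proof -
  have "up_closure (minimal_exps n U) \<subseteq> U"
    using assms by (auto simp: up_closure_def minimal_exps_def up_closed_def)
  moreover have "a \<in> up_closure (minimal_exps n U)" if "a \<in> U" "Poly_Mapping.keys a \<subseteq> {1..n}" for a
    using minimal_exps_below[OF that] by (auto simp: up_closure_def)
  ultimately show ?thesis
    by (auto simp: monomial_ideal_def mpoly_carrier_iff subset_iff)
qed

text \<open>A minimal exponent is a multiple of some generator's exponent; the latter also lies in
  \<open>U\<close>, so minimality makes the two equal.\<close>

lemma minimal_exps_generate:
  assumes U: "up_closed U" and A: "\<And>a. a \<in> A \<Longrightarrow> Poly_Mapping.keys a \<subseteq> {1..n}"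
    and eq: "(monomial_ideal n (up_closure A) :: ('k::field) mpoly set) = monomial_ideal n U"
  shows "minimal_exps n U \<subseteq> A"
proof
  fix a assume a: "a \<in> minimal_exps n U"
  then have "Poly_Mapping.single a (1::'k) \<in> monomial_ideal n U"
    by (auto simp: single_in_monomial_ideal minimal_exps_def)
  then have "Poly_Mapping.single a (1::'k) \<in> monomial_ideal n (up_closure A)" using eq by simp
  then obtain b c where bc: "a = b + c" "b \<in> A"
    by (auto simp: single_in_monomial_ideal up_closure_def)
  have "b \<in> up_closure A" using bc subset_up_closure by blast
  then have "Poly_Mapping.single b (1::'k) \<in> monomial_ideal n U"
    using A[OF bc(2)] unfolding eq[symmetric] single_in_monomial_ideal by blast
  then have "b \<in> U" by (simp add: single_in_monomial_ideal)
  then show "a \<in> A" using minimal_exps_divisor[OF U] a bc by force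
qed

text \<open>The minimal monomials generate the ideal and lie in every generating set of monomials.
  They therefore form the only generating set of monomials that is minimal under inclusion.\<close>

lemma min_gens_monomial_ideal:
  assumes U: "up_closed U"
  shows "min_gens n (monomial_ideal n U :: ('k::field) mpoly set) = (\<lambda>a. Poly_Mapping.single a 1) ` minimal_exps n U"
  unfolding min_gens_def
proof (rule the_equality)
  let ?x = "\<lambda>a. Poly_Mapping.single a (1::'k)"
  have keys: "\<And>a. a \<in> minimal_exps n U \<Longrightarrow> Poly_Mapping.keys a \<subseteq> {1..n}"
    by (simp add: minimal_exps_def)
  have Idl: "Idl\<^bsub>mpoly_ring n\<^esub> (?x ` minimal_exps n U) = monomial_ideal n U"
    by (rule trans[OF Idl_monomials[OF keys] up_closure_minimal_exps[OF U]])
  have least: "?x ` minimal_exps n U \<subseteq> B"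
    if B: "B \<subseteq> monomials n" "Idl\<^bsub>mpoly_ring n\<^esub> B = monomial_ideal n U" for B
  proof -
    define A where "A = {a. Poly_Mapping.keys a \<subseteq> {1..n} \<and> ?x a \<in> B}"
    have "B = ?x ` A" using B(1) by (auto simp: A_def monomials_def)
    moreover have A: "\<And>a. a \<in> A \<Longrightarrow> Poly_Mapping.keys a \<subseteq> {1..n}" by (simp add: A_def)
    ultimately have "(monomial_ideal n (up_closure A) :: 'k mpoly set) = monomial_ideal n U"
      using Idl_monomials[of A n, OF A, where ?'k = 'k] B(2) by simp
    then show ?thesis
      using minimal_exps_generate[OF U A] \<open>B = ?x ` A\<close> by blast
  qed
  have sub: "?x ` minimal_exps n U \<subseteq> monomials n" using keys by (auto simp: monomials_def)
  show "?x ` minimal_exps n U \<subseteq> monomials n \<and> Idl\<^bsub>mpoly_ring n\<^esub> (?x ` minimal_exps n U) = monomial_ideal n U \<and>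
    (\<forall>B. B \<subset> ?x ` minimal_exps n U \<longrightarrow> Idl\<^bsub>mpoly_ring n\<^esub> B \<noteq> monomial_ideal n U)"
    using sub Idl least by blast
  fix A :: "'k mpoly set" assume "A \<subseteq> monomials n \<and> Idl\<^bsub>mpoly_ring n\<^esub> A = monomial_ideal n U \<and>
    (\<forall>B. B \<subset> A \<longrightarrow> Idl\<^bsub>mpoly_ring n\<^esub> B \<noteq> monomial_ideal n U)"
  then show "A = ?x ` minimal_exps n U" using least[of A] Idl by blast
qed

section \<open>Ideals generated by variables\<close>

text \<open>The exponents of the monomials in the \<open>l\<close>-th power of the ideal generated
  by the variables in \<open>F\<close>.\<close>

definition weight_exps :: "nat set \<Rightarrow> nat \<Rightarrow> (nat \<Rightarrow>\<^sub>0 nat) set" where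
  "weight_exps F l = {a. l \<le> (\<Sum>i\<in>F. Poly_Mapping.lookup a i)}"

lemma up_closed_weight_exps: "up_closed (weight_exps F l)"
  by (auto simp: up_closed_def weight_exps_def lookup_add sum.distrib)

lemma weight_exps_1:
  assumes "finite F"
  shows "a \<in> weight_exps F 1 \<longleftrightarrow> Poly_Mapping.keys a \<inter> F \<noteq> {}"
proof -
  have "a \<in> weight_exps F 1 \<longleftrightarrow> (\<Sum>i\<in>F. Poly_Mapping.lookup a i) \<noteq> 0"
    by (auto simp: weight_exps_def)
  also have "\<dots> \<longleftrightarrow> Poly_Mapping.keys a \<inter> F \<noteq> {}"
    using assms by (auto simp: in_keys_iff)
  finally show ?thesis .
qed

lemma up_closure_vars:
  assumes "finite F"
  shows "up_closure ((\<lambda>i. Poly_Mapping.single i 1) ` F) = weight_exps F 1"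
proof (intro equalityI subsetI)
  fix a assume "a \<in> up_closure ((\<lambda>i. Poly_Mapping.single i 1) ` F)"
  then obtain i b where "i \<in> F" "a = Poly_Mapping.single i 1 + b" by (auto simp: up_closure_def)
  then have "i \<in> Poly_Mapping.keys a \<inter> F" by (simp add: keys_add_exp)
  then show "a \<in> weight_exps F 1" unfolding weight_exps_1[OF assms] by blast
next
  fix a assume "a \<in> weight_exps F 1"
  then obtain i where i: "i \<in> Poly_Mapping.keys a" "i \<in> F" unfolding weight_exps_1[OF assms] by blast
  have "a = Poly_Mapping.single i 1 + (a - Poly_Mapping.single i 1)"
    using exp_split[OF i(1)] by (simp add: add.commute)
  then show "a \<in> up_closure ((\<lambda>i. Poly_Mapping.single i 1) ` F)"
    unfolding up_closure_def using i(2) by blast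
qed

lemma var_ideal_eq:
  assumes "F \<subseteq> {1..n}"
  shows "(var_ideal n F :: ('k::field) mpoly set) = monomial_ideal n (weight_exps F 1)"
proof -
  have "finite F" using assms finite_subset by blast
  let ?A = "(\<lambda>i. Poly_Mapping.single i (1::nat)) ` F"
  have "(var ` F :: 'k mpoly set) = (\<lambda>a. Poly_Mapping.single a 1) ` ?A"
    by (simp add: var_def image_image)
  moreover have "\<And>a. a \<in> ?A \<Longrightarrow> Poly_Mapping.keys a \<subseteq> {1..n}" using assms by auto
  ultimately show ?thesis
    unfolding var_ideal_def using Idl_monomials[of ?A n] up_closure_vars[OF \<open>finite F\<close>] by simp
qed

lemma var_ideal_ideal:
  "F \<subseteq> {1..n} \<Longrightarrow> ideal (var_ideal n F :: ('k::field) mpoly set) (mpoly_ring n)"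
  by (simp add: var_ideal_eq monomial_ideal_ideal up_closed_weight_exps)

lemma var_ideal_carrier:
  "F \<subseteq> {1..n} \<Longrightarrow> (var_ideal n F :: ('k::field) mpoly set) \<subseteq> carrier (mpoly_ring n)"
  by (auto simp: var_ideal_eq monomial_ideal_def)

lemma single_in_var_ideal:
  assumes "F \<subseteq> {1..n}" "Poly_Mapping.keys a \<subseteq> {1..n}"
  shows "Poly_Mapping.single a (1::'k::field) \<in> var_ideal n F \<longleftrightarrow> Poly_Mapping.keys a \<inter> F \<noteq> {}"
proof -
  have "finite F" using assms finite_subset by blast
  then show ?thesis
    using assms by (simp add: var_ideal_eq single_in_monomial_ideal weight_exps_1[simplified])
qed

text \<open>Modulo the ideal, a polynomial may be truncated to the monomials avoiding \<open>F\<close>; a product of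
  truncations that lies in the ideal must vanish.\<close>

lemma var_ideal_prime:
  assumes F: "F \<subseteq> {1..n}"
  shows "primeideal (var_ideal n F :: ('k::field) mpoly set) (mpoly_ring n)"
proof (rule primeidealI[OF var_ideal_ideal[OF F] mpoly_cring])
  let ?P = "var_ideal n F :: 'k mpoly set"
  have J: "ideal ?P (mpoly_ring n)" by (rule var_ideal_ideal[OF F])
  have fin: "finite F" using F finite_subset by blast
  have P: "p \<in> ?P \<longleftrightarrow> p \<in> carrier (mpoly_ring n) \<and> (\<forall>a\<in>Poly_Mapping.keys p. Poly_Mapping.keys a \<inter> F \<noteq> {})" for p
    unfolding var_ideal_eq[OF F] monomial_ideal_def using weight_exps_1[OF fin] by blast
  have "(1 :: 'k mpoly) \<notin> ?P" by (simp add: P)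
  moreover have "(1 :: 'k mpoly) \<in> carrier (mpoly_ring n)" by (simp add: mpoly_carrier_iff)
  ultimately show "carrier (mpoly_ring n) \<noteq> ?P" by blast
  define trunc :: "'k mpoly \<Rightarrow> 'k mpoly" where
    "trunc p = (\<Sum>a\<in>{a \<in> Poly_Mapping.keys p. Poly_Mapping.keys a \<inter> F = {}}. Poly_Mapping.single a (Poly_Mapping.lookup p a))" for p
  have lookup_trunc: "Poly_Mapping.lookup (trunc p) a = (if Poly_Mapping.keys a \<inter> F = {} then Poly_Mapping.lookup p a else 0)" for p a
    by (simp add: trunc_def lookup_sum lookup_single when_def in_keys_iff)
  have keys_trunc: "Poly_Mapping.keys (trunc p) = {a \<in> Poly_Mapping.keys p. Poly_Mapping.keys a \<inter> F = {}}" for p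
  proof (rule Set.set_eqI)
    show "a \<in> Poly_Mapping.keys (trunc p) \<longleftrightarrow> a \<in> {a \<in> Poly_Mapping.keys p. Poly_Mapping.keys a \<inter> F = {}}" for a
      unfolding mem_Collect_eq in_keys_iff[of a] lookup_trunc by simp
  qed
  have trunc_carrier: "trunc p \<in> carrier (mpoly_ring n)" if "p \<in> carrier (mpoly_ring n)" for p
    using that by (auto simp: mpoly_carrier_iff keys_trunc)
  have diff: "p - trunc p \<in> ?P" if p: "p \<in> carrier (mpoly_ring n)" for p
  proof -
    have "p + - trunc p \<in> carrier (mpoly_ring n)"
      by (intro mpoly_carrier_add mpoly_carrier_uminus trunc_carrier p)
    moreover have "Poly_Mapping.keys a \<inter> F \<noteq> {}" if "a \<in> Poly_Mapping.keys (p - trunc p)" for a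
      using that by (auto simp: in_keys_iff lookup_minus lookup_trunc)
    ultimately show ?thesis by (simp add: P)
  qed
  fix p q :: "'k mpoly"
  assume p: "p \<in> carrier (mpoly_ring n)" and q: "q \<in> carrier (mpoly_ring n)"
    and "p \<otimes>\<^bsub>mpoly_ring n\<^esub> q \<in> ?P"
  then have pq: "p * q \<in> ?P" by simp
  \<comment> \<open>The two products add up to \<open>p * q - trunc p * trunc q\<close>.\<close>
  have "(p - trunc p) * q \<in> ?P"
    using ideal.I_r_closed[OF J diff[OF p] q] by simp
  moreover have "trunc p * (q - trunc q) \<in> ?P"
    using ideal.I_l_closed[OF J diff[OF q] trunc_carrier[OF p]] by simp
  ultimately have "(p - trunc p) * q + trunc p * (q - trunc q) \<in> ?P"
    by (rule ideal_add[OF J])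
  then have "- ((p - trunc p) * q + trunc p * (q - trunc q)) \<in> ?P"
    unfolding P keys_uminus using mpoly_carrier_uminus by blast
  then have "p * q + - ((p - trunc p) * q + trunc p * (q - trunc q)) \<in> ?P"
    by (rule ideal_add[OF J pq])
  then have "trunc p * trunc q \<in> ?P" by (simp add: algebra_simps)
  \<comment> \<open>Every monomial of this product avoids \<open>F\<close>, whereas membership in
    the ideal makes it meet \<open>F\<close>; hence there are none, and the absence of zero divisors
    finishes the argument.\<close>
  moreover have "Poly_Mapping.keys (trunc p * trunc q) \<subseteq> {a. Poly_Mapping.keys a \<inter> F = {}}"
    by (rule keys_mult_subset) (auto simp: keys_trunc keys_add_exp)
  ultimately have "Poly_Mapping.keys (trunc p * trunc q) = {}" unfolding P by blast
  then have "trunc p * trunc q = 0" by simp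
  then have "trunc p = 0 \<or> trunc q = 0" by simp
  then show "p \<in> ?P \<or> q \<in> ?P" using diff[OF p] diff[OF q] by auto
qed

text \<open>Degrees in the variables of \<open>F\<close> add under multiplication. Conversely, a
  monomial of such degree at least \<open>Suc l\<close> has a variable of \<open>F\<close> to split
  off.\<close>

lemma monomial_ideal_prod_vars:
  assumes F: "F \<subseteq> {1..n}"
  shows "ideal_prod (mpoly_ring n) (monomial_ideal n (weight_exps F l)) (monomial_ideal n (weight_exps F 1)) =
    (monomial_ideal n (weight_exps F (Suc l)) :: ('k::field) mpoly set)"
    (is "ideal_prod _ ?I ?J = ?K")
proof
  interpret cring "mpoly_ring n :: 'k mpoly ring" by (rule mpoly_cring)
  have fin: "finite F" using F finite_subset by blast
  have K: "ideal ?K (mpoly_ring n)" by (intro monomial_ideal_ideal up_closed_weight_exps)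
  show "ideal_prod (mpoly_ring n) ?I ?J \<subseteq> ?K"
  proof
    fix s assume "s \<in> ideal_prod (mpoly_ring n) ?I ?J"
    then show "s \<in> ?K"
    proof induction
      case (prod p q)
      then have "Poly_Mapping.keys (p * q) \<subseteq> weight_exps F (Suc l)"
        by (intro keys_mult_subset)
          (auto simp: monomial_ideal_def weight_exps_def lookup_add sum.distrib dest!: subsetD)
      then show ?case using prod by (simp add: monomial_ideal_def mpoly_carrier_mult)
    next
      case (sum p q)
      then show ?case using ideal_add[OF K] by simp
    qed
  qed
  have prod: "ideal (ideal_prod (mpoly_ring n) ?I ?J) (mpoly_ring n)"
    by (intro ideal_prod_is_ideal monomial_ideal_ideal up_closed_weight_exps)
  show "?K \<subseteq> ideal_prod (mpoly_ring n) ?I ?J"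
  proof (rule monomial_ideal_subset[OF prod])
    fix a assume a: "a \<in> weight_exps F (Suc l)" and keys: "Poly_Mapping.keys a \<subseteq> {1..n}"
    then have "a \<in> weight_exps F 1" by (simp add: weight_exps_def)
    then obtain i where i: "i \<in> Poly_Mapping.keys a" "i \<in> F" unfolding weight_exps_1[OF fin] by blast
    define b where "b = a - Poly_Mapping.single i 1"
    have ab: "a = b + Poly_Mapping.single i 1" unfolding b_def by (rule exp_split[OF i(1)])
    have "(\<Sum>i\<in>F. Poly_Mapping.lookup a i) = Suc (\<Sum>i\<in>F. Poly_Mapping.lookup b i)"
      using fin i(2) by (simp add: ab lookup_add sum.distrib lookup_single when_def)
    then have "b \<in> weight_exps F l" using a by (simp add: weight_exps_def)
    then have "Poly_Mapping.single b (1::'k) \<in> ?I"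
      using keys by (simp add: single_in_monomial_ideal ab keys_add_exp)
    moreover have "Poly_Mapping.single (Poly_Mapping.single i 1) (1::'k) \<in> ?J"
      using i F by (auto simp: single_in_monomial_ideal weight_exps_1[OF fin, simplified])
    ultimately have "Poly_Mapping.single b (1::'k) \<otimes>\<^bsub>mpoly_ring n\<^esub> Poly_Mapping.single (Poly_Mapping.single i 1) (1::'k)
        \<in> ideal_prod (mpoly_ring n) ?I ?J"
      by (rule ideal_prod.prod)
    then show "Poly_Mapping.single a (1::'k) \<in> ideal_prod (mpoly_ring n) ?I ?J"
      by (simp add: mult_single ab)
  qed
qed

lemma var_ideal_power:
  assumes F: "F \<subseteq> {1..n}"
  shows "var_ideal n F [^]\<^bsub>ideals_set (mpoly_ring n)\<^esub> l = (monomial_ideal n (weight_exps F l) :: ('k::field) mpoly set)"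
proof (induction l)
  case 0
  \<comment> \<open>The zeroth power is the unit of the monoid of ideals, that is, the whole
    ring.\<close>
  have "weight_exps F 0 = UNIV" by (simp add: weight_exps_def)
  then show ?case by (simp add: nat_pow_def ideals_set_def monomial_ideal_def)
next
  case (Suc l)
  then show ?case
    using monomial_ideal_prod_vars[OF F, of l] by (simp add: nat_pow_def ideals_set_def var_ideal_eq[OF F])
qed

section \<open>Primes over the Stanley--Reisner ideal\<close>

lemma keys_indicator_exp: "finite S \<Longrightarrow> Poly_Mapping.keys (indicator_exp S) = S"
  by (auto simp: in_keys_iff lookup_indicator_exp)

lemma single_sum: "Poly_Mapping.single (sum f A) (1::'k::field) = (\<Prod>a\<in>A. Poly_Mapping.single (f a) 1)"
  for f :: "'b \<Rightarrow> nat \<Rightarrow>\<^sub>0 nat"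
proof (induction A rule: infinite_finite_induct)
  case (insert a A)
  then show ?case by (simp add: mult_single flip: insert.IH)
qed simp_all

lemma prod_var: "(\<Prod>i\<in>S. var i) = Poly_Mapping.single (indicator_exp S) (1::'k::field)"
  by (simp add: indicator_exp_def single_sum var_def)

text \<open>Primality is applied factor by factor; the empty product is 1, which a proper ideal does
  not contain.\<close>

lemma primeideal_prod_notin:
  assumes Q: "primeideal Q (mpoly_ring n)" and S: "S \<subseteq> {1..n}" "\<And>i. i \<in> S \<Longrightarrow> var i \<notin> Q"
  shows "(\<Prod>i\<in>S. var i) \<notin> (Q :: ('k::field) mpoly set)"
proof -
  have "finite S" using S finite_subset by blast
  then show ?thesis using S
  proof (induction S)
    case empty
    have "\<one>\<^bsub>mpoly_ring n\<^esub> \<notin> Q"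
      using ideal.one_imp_carrier[OF primeideal.axioms(1)[OF Q]] primeideal.I_notcarr[OF Q] by blast
    then show ?case by simp
  next
    case (insert i S)
    have "finite S" using insert by simp
    then have "(\<Prod>i\<in>S. var i) \<in> carrier (mpoly_ring n :: 'k mpoly ring)"
      unfolding prod_var using insert.prems by (simp add: mpoly_carrier_iff keys_indicator_exp)
    moreover have "var i \<in> carrier (mpoly_ring n :: 'k mpoly ring)"
      using insert.prems by (simp add: mpoly_carrier_iff var_def)
    ultimately show ?case
      using primeideal.I_prime[OF Q, of "var i" "\<Prod>i\<in>S. var i"] insert by auto
  qed
qed

text \<open>The product of the variables outside \<open>Q\<close> is not in \<open>Q\<close>, hence outside one of the intersected
  ideals.\<close>

lemma primeideal_contains_var_ideal:
  assumes Q: "primeideal (Q :: ('k::field) mpoly set) (mpoly_ring n)"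
    and sub: "carrier (mpoly_ring n) \<inter> (\<Inter>F\<in>\<F>. var_ideal n ({1..n} - F)) \<subseteq> Q"
  shows "\<exists>F\<in>\<F>. var_ideal n ({1..n} - F) \<subseteq> Q"
proof -
  define S where "S = {i \<in> {1..n}. (var i :: 'k mpoly) \<notin> Q}"
  have S: "S \<subseteq> {1..n}" "finite S" by (auto simp: S_def)
  have "(\<Prod>i\<in>S. var i) \<notin> Q" by (rule primeideal_prod_notin[OF Q]) (auto simp: S_def)
  moreover have "(\<Prod>i\<in>S. var i) \<in> carrier (mpoly_ring n :: 'k mpoly ring)"
    using S by (simp add: prod_var mpoly_carrier_iff keys_indicator_exp)
  ultimately obtain F where F: "F \<in> \<F>" "(\<Prod>i\<in>S. var i) \<notin> (var_ideal n ({1..n} - F) :: 'k mpoly set)"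
    using sub by blast
  then have "S \<inter> ({1..n} - F) = {}"
    using S by (simp add: prod_var single_in_var_ideal keys_indicator_exp)
  then have "var ` ({1..n} - F) \<subseteq> Q" by (auto simp: S_def)
  then have "var_ideal n ({1..n} - F) \<subseteq> Q"
    unfolding var_ideal_def by (rule ring.genideal_minimal[OF mpoly_ring primeideal.axioms(1)[OF Q]])
  then show ?thesis using F(1) by blast
qed

text \<open>An associated prime, the annihilator of the class of \<open>f\<close>, contains some
  \<open>?P F\<close> with \<open>f\<close> outside it; since \<open>?P F\<close> is prime, the two
  coincide. Conversely, each \<open>?P F\<close> is the annihilator of the class of the product of
  the variables in \<open>F\<close>.\<close>

lemma associated_primes_stanley_reisner:
  assumes M: "matroid n \<Delta>"
  shows "associated_primes (mpoly_ring n) (stanley_reisner_ideal n \<Delta> :: ('k::field) mpoly set) =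
    (\<lambda>F. var_ideal n ({1..n} - F)) ` facets \<Delta>"
proof (intro equalityI subsetI)
  let ?P = "\<lambda>F. var_ideal n ({1..n} - F) :: 'k mpoly set"
  let ?I = "stanley_reisner_ideal n \<Delta> :: 'k mpoly set"
  have prime: "primeideal (?P F) (mpoly_ring n)" for F by (rule var_ideal_prime) auto
  have I: "p \<in> ?I \<longleftrightarrow> (\<forall>F\<in>facets \<Delta>. p \<in> ?P F)" for p by (simp add: stanley_reisner_ideal_def)
  have mult: "p * q \<in> ?P F" if "p \<in> ?P F \<or> q \<in> ?P F" "p \<in> carrier (mpoly_ring n)" "q \<in> carrier (mpoly_ring n)" for p q F
    using that ideal.I_r_closed[OF primeideal.axioms(1)[OF prime]] ideal.I_l_closed[OF primeideal.axioms(1)[OF prime]] by fastforce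
  {
    fix p assume "p \<in> associated_primes (mpoly_ring n) ?I"
    then obtain f where p: "primeideal p (mpoly_ring n)" "f \<in> carrier (mpoly_ring n)"
      "p = {r \<in> carrier (mpoly_ring n). r * f \<in> ?I}" by (auto simp: associated_primes_def)
    \<comment> \<open>Components that contain \<open>f\<close> impose no condition on
      \<open>r\<close> in \<open>r * f \<in> ?I\<close>, so only the others are intersected.\<close>
    let ?F = "{F \<in> facets \<Delta>. f \<notin> ?P F}"
    have "carrier (mpoly_ring n) \<inter> (\<Inter>F\<in>?F. ?P F) \<subseteq> p"
    proof
      fix r assume r: "r \<in> carrier (mpoly_ring n) \<inter> (\<Inter>F\<in>?F. ?P F)"
      then have "r * f \<in> ?P F" if "F \<in> facets \<Delta>" for F
        using that by (intro mult p(2)) auto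
      then show "r \<in> p" using r by (simp add: p(3) I)
    qed
    then obtain F where F: "F \<in> facets \<Delta>" "f \<notin> ?P F" "?P F \<subseteq> p"
      using primeideal_contains_var_ideal[OF p(1)] by blast
    have "p \<subseteq> ?P F"
    proof
      fix r assume "r \<in> p"
      then have "r \<in> carrier (mpoly_ring n)" "r * f \<in> ?P F" using F(1) by (auto simp: p(3) I)
      then show "r \<in> ?P F" using primeideal.I_prime[OF prime, of r f F] p(2) F(2) by auto
    qed
    then show "p \<in> ?P ` facets \<Delta>" using F by blast
  }
  fix p assume "p \<in> ?P ` facets \<Delta>"
  then obtain F where F: "F \<in> facets \<Delta>" "p = ?P F" by blast
  have Fn: "F \<subseteq> {1..n}" "finite F" using facet_subset[OF M F(1)] finite_subset by auto
  \<comment> \<open>Distinct facets are not nested, so \<open>f\<close> lies in every component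
    except the one of \<open>F\<close>.\<close>
  define f :: "'k mpoly" where "f = Poly_Mapping.single (indicator_exp F) 1"
  have f: "f \<in> carrier (mpoly_ring n)" using Fn by (simp add: f_def mpoly_carrier_iff keys_indicator_exp)
  have f_iff: "f \<in> ?P G \<longleftrightarrow> F \<inter> ({1..n} - G) \<noteq> {}" for G
    using Fn by (simp add: f_def single_in_var_ideal keys_indicator_exp)
  have "r \<in> ?P F \<longleftrightarrow> r \<in> carrier (mpoly_ring n) \<and> r * f \<in> ?I" for r
  proof
    assume r: "r \<in> ?P F"
    then have rc: "r \<in> carrier (mpoly_ring n)" using var_ideal_carrier[of "{1..n} - F" n] by auto
    have "r * f \<in> ?P G" if G: "G \<in> facets \<Delta>" for G
    proof (cases "G = F")
      case False
      then have "\<not> F \<subseteq> G" using F(1) G unfolding facets_def by blast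
      then have "f \<in> ?P G" using Fn unfolding f_iff by blast
      then show ?thesis using mult rc f by blast
    qed (use r rc f mult in blast)
    then show "r \<in> carrier (mpoly_ring n) \<and> r * f \<in> ?I" using rc I by blast
  next
    assume r: "r \<in> carrier (mpoly_ring n) \<and> r * f \<in> ?I"
    then have "r * f \<in> ?P F" using F(1) I by blast
    moreover have "f \<notin> ?P F" unfolding f_iff by blast
    ultimately show "r \<in> ?P F" using primeideal.I_prime[OF prime, of r f F] r f by auto
  qed
  then have "?P F = {r \<in> carrier (mpoly_ring n). r * f \<in> ?I}" by blast
  then show "p \<in> associated_primes (mpoly_ring n) ?I"
    unfolding associated_primes_def F(2) mem_Collect_eq mpoly_ring_simps by (intro conjI prime bexI[of _ f] f)
qed

lemma symbolic_power_stanley_reisner: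
  assumes M: "matroid n \<Delta>"
  shows "symbolic_power (mpoly_ring n) (stanley_reisner_ideal n \<Delta> :: ('k::field) mpoly set) l =
    monomial_ideal n (symbolic_exps n \<Delta> l)"
proof -
  have "symbolic_power (mpoly_ring n) (stanley_reisner_ideal n \<Delta> :: 'k mpoly set) l =
      carrier (mpoly_ring n) \<inter> (\<Inter>F\<in>facets \<Delta>. monomial_ideal n (weight_exps ({1..n} - F) l))"
    by (simp add: symbolic_power_def associated_primes_stanley_reisner[OF M] var_ideal_power)
  also have "\<dots> = monomial_ideal n (symbolic_exps n \<Delta> l)"
    by (auto simp: monomial_ideal_def symbolic_exps_def weight_exps_def subset_iff)
  finally show ?thesis .
qed

lemma up_closed_symbolic_exps: "up_closed (symbolic_exps n \<Delta> l)"
  using up_closed_weight_exps by (auto simp: up_closed_def symbolic_exps_def weight_exps_def)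

section \<open>A lower bound for the height\<close>

lemma var_ideal_strict_mono:
  assumes "F \<subset> G" "G \<subseteq> {1..n}"
  shows "(var_ideal n F :: ('k::field) mpoly set) \<subset> var_ideal n G"
proof
  show "(var_ideal n F :: 'k mpoly set) \<subseteq> var_ideal n G"
  proof (unfold var_ideal_def[of n F], rule ring.genideal_minimal[OF mpoly_ring var_ideal_ideal[OF assms(2)]])
    have "(var i :: 'k mpoly) \<in> var_ideal n G" if "i \<in> F" for i
    proof -
      have "i \<in> G" "i \<in> {1..n}" using that assms by auto
      then show ?thesis unfolding var_def by (subst single_in_var_ideal[OF assms(2)]) auto
    qed
    then show "(var ` F :: 'k mpoly set) \<subseteq> var_ideal n G" by blast
  qed
  obtain i where i: "i \<in> G" "i \<notin> F" "i \<in> {1..n}" using assms by blast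
  then have "(var i :: 'k mpoly) \<in> var_ideal n G"
    unfolding var_def by (subst single_in_var_ideal[OF assms(2)]) auto
  moreover have "(var i :: 'k mpoly) \<notin> var_ideal n F"
    unfolding var_def using assms i by (subst single_in_var_ideal) auto
  ultimately show "(var_ideal n F :: 'k mpoly set) \<noteq> var_ideal n G" by blast
qed

text \<open>Adjoining the variables of \<open>G\<close> one at a time gives a strictly increasing
  chain of primes inside \<open>Q\<close>.\<close>

lemma prime_height_ge:
  assumes Q: "primeideal (Q :: ('k::field) mpoly set) (mpoly_ring n)" and G: "G \<subseteq> {1..n}" "var_ideal n G \<subseteq> Q"
    and m: "m \<le> card G"
  shows "enat m \<le> prime_height (mpoly_ring n) Q"
proof -
  have "finite G" using G finite_subset by blast
  then obtain xs where xs: "set xs = G" "distinct xs" using finite_distinct_list by blast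
  have len: "m \<le> length xs" using m xs distinct_card by fastforce
  have sub: "set (take i xs) \<subseteq> {1..n}" for i using set_take_subset[of i xs] xs(1) G(1) by blast
  \<comment> \<open>The chain must end in \<open>Q\<close> itself, so \<open>Q\<close> takes the
    place of the ideal at index \<open>m\<close>.\<close>
  define C :: "nat \<Rightarrow> 'k mpoly set" where "C i = (if i < m then var_ideal n (set (take i xs)) else Q)" for i
  have step: "(var_ideal n (set (take i xs)) :: 'k mpoly set) \<subset> var_ideal n (set (take (Suc i) xs))" if "i < m" for i
  proof (rule var_ideal_strict_mono[OF _ sub])
    have "xs ! i \<notin> set (take i xs)"
      using xs(2) that len by (auto simp: in_set_conv_nth nth_eq_iff_index_eq)
    then show "set (take i xs) \<subset> set (take (Suc i) xs)"
      using that len by (auto simp: take_Suc_conv_app_nth)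
  qed
  have "C i \<subset> C (Suc i)" if i: "i < m" for i
  proof (cases "Suc i < m")
    case True
    then show ?thesis using step[OF i] by (simp add: C_def)
  next
    case False
    \<comment> \<open>For the last step, the next ideal generated by variables still lies in
      \<open>Q\<close>, so the inclusion of the present one in \<open>Q\<close> is strict.\<close>
    have "set (take (Suc i) xs) \<subset> G \<or> set (take (Suc i) xs) = G"
      using set_take_subset[of "Suc i" xs] xs(1) by blast
    then have "(var_ideal n (set (take (Suc i) xs)) :: 'k mpoly set) \<subseteq> var_ideal n G"
      using var_ideal_strict_mono[OF _ G(1)] by blast
    then have "var_ideal n (set (take i xs)) \<subset> Q" using step[OF i] G(2) by blast
    then show ?thesis using i False by (simp add: C_def)
  qed
  moreover have "primeideal (C i) (mpoly_ring n)" for i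
    by (cases "i < m") (simp_all add: C_def Q var_ideal_prime[OF sub])
  moreover have "C m = Q" by (simp add: C_def)
  ultimately show ?thesis
    unfolding prime_height_def by (intro Sup_upper CollectI exI[of _ m] exI[of _ C]) auto
qed

text \<open>Every prime over the ideal contains the variables outside some facet. Applied to
  nullities, which never exceed the size of a facet's complement, this yields the bound by the
  height in the theorem.\<close>

lemma ideal_height_stanley_reisner_ge:
  assumes m: "\<And>F. F \<in> facets \<Delta> \<Longrightarrow> m \<le> card ({1..n} - F)"
  shows "enat m \<le> ideal_height (mpoly_ring n) (stanley_reisner_ideal n \<Delta> :: ('k::field) mpoly set)"
  unfolding ideal_height_def
proof (rule Inf_greatest, clarify)
  fix Q :: "'k mpoly set"
  assume Q: "primeideal Q (mpoly_ring n)" and sub: "stanley_reisner_ideal n \<Delta> \<subseteq> Q"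
  then obtain F where "F \<in> facets \<Delta>" "var_ideal n ({1..n} - F) \<subseteq> Q"
    using primeideal_contains_var_ideal[OF Q, of "facets \<Delta>"] by (auto simp: stanley_reisner_ideal_def)
  then show "enat m \<le> prime_height (mpoly_ring n) Q"
    using prime_height_ge[OF Q, of "{1..n} - F" m] m by auto
qed

section \<open>Symbolic powers of matroid ideals\<close>

text \<open>The case of a single layer in \<open>symbolic_exps_minimal_layers\<close>. It translates
  between squarefree minimal generators and the condition imposed on each layer.\<close>

lemma indicator_minimal_iff:
  assumes M: "matroid n \<Delta>" and S: "S \<subseteq> {1..n}" and c: "1 \<le> c"
  shows "indicator_exp S \<in> minimal_exps n (symbolic_exps n \<Delta> c) \<longleftrightarrow>
    nullity \<Delta> S = c \<and> (\<forall>i\<in>S. nullity \<Delta> (S - {i}) < nullity \<Delta> S)"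
proof -
  define C where "C j = (if j = 0 then S else {})" for j :: nat
  have "antimono C" "\<And>j. C j \<subseteq> {1..n}" "\<And>j. 1 \<le> j \<Longrightarrow> C j = {}"
    using S by (auto simp: C_def antimono_def)
  moreover have "indicator_exp S = (\<Sum>j<1. indicator_exp (C j))" by (simp add: C_def)
  ultimately have "indicator_exp S \<in> symbolic_exps n \<Delta> c \<and>
      (\<forall>i a'. indicator_exp S = a' + Poly_Mapping.single i 1 \<longrightarrow> a' \<notin> symbolic_exps n \<Delta> c) \<longleftrightarrow>
      (\<Sum>j<1. nullity \<Delta> (C j)) = c \<and> (\<forall>j<1. \<forall>i\<in>C j. nullity \<Delta> (C j - {i}) < nullity \<Delta> (C j))"
    by (intro symbolic_exps_minimal_layers[OF M _ _ _ c])
  moreover have "Poly_Mapping.keys (indicator_exp S) \<subseteq> {1..n}"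
    using S finite_subset[OF S] by (simp add: keys_indicator_exp)
  ultimately show ?thesis unfolding minimal_exps_def by (simp add: C_def)
qed

section \<open>Supports and layers of monomials\<close>

lemma var_divides_single:
  assumes "i \<in> {1..n}" "Poly_Mapping.keys a \<subseteq> {1..n}"
  shows "var i divides\<^bsub>mpoly_ring n\<^esub> Poly_Mapping.single a (1::'k::field) \<longleftrightarrow> i \<in> Poly_Mapping.keys a"
proof
  assume "var i divides\<^bsub>mpoly_ring n\<^esub> Poly_Mapping.single a (1::'k)"
  then obtain q where q: "Poly_Mapping.single a (1::'k) = var i * q" by (auto simp: factor_def)
  have "Poly_Mapping.keys (var i * q) \<subseteq> {b. i \<in> Poly_Mapping.keys b}"
    by (rule keys_mult_subset) (simp add: var_def keys_add_exp)
  then show "i \<in> Poly_Mapping.keys a" unfolding q[symmetric] by simp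
next
  assume i: "i \<in> Poly_Mapping.keys a"
  let ?b = "a - Poly_Mapping.single i 1"
  have a: "a = ?b + Poly_Mapping.single i 1" by (rule exp_split[OF i])
  have "Poly_Mapping.keys a = Poly_Mapping.keys ?b \<union> {i}"
    by (subst a) (simp only: keys_add_exp keys_single, simp)
  then have "Poly_Mapping.single ?b (1::'k) \<in> carrier (mpoly_ring n)"
    using assms(2) by (simp add: mpoly_carrier_iff)
  moreover have "Poly_Mapping.single a (1::'k) = var i * Poly_Mapping.single ?b 1"
    unfolding var_def mult_single by (subst a) (simp only: add.commute mult_1)
  ultimately show "var i divides\<^bsub>mpoly_ring n\<^esub> Poly_Mapping.single a (1::'k)"
    by (auto simp: factor_def)
qed

text \<open>Allows inclusions between supports, which are sets of polynomials, to be read as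
  inclusions between index sets.\<close>

lemma inj_var: "inj (var :: nat \<Rightarrow> ('k::field) mpoly)"
proof (rule injI)
  fix i j :: nat assume "(var i :: 'k mpoly) = var j"
  then have "Poly_Mapping.keys (var i :: 'k mpoly) = Poly_Mapping.keys (var j :: 'k mpoly)" by simp
  then have "Poly_Mapping.single i (1::nat) = Poly_Mapping.single j 1" by (simp add: var_def)
  then have "Poly_Mapping.keys (Poly_Mapping.single i (1::nat)) = Poly_Mapping.keys (Poly_Mapping.single j (1::nat))" by simp
  then show "i = j" by simp
qed

lemma supp_indicator:
  assumes "S \<subseteq> {1..n}"
  shows "supp n (Poly_Mapping.single (indicator_exp S) (1::'k::field)) = var ` S"
proof -
  have keys: "Poly_Mapping.keys (indicator_exp S) = S"
    using assms finite_subset by (intro keys_indicator_exp) blast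
  show ?thesis
    unfolding supp_def using assms var_divides_single[of _ n "indicator_exp S"] unfolding keys by blast
qed

lemma prod_list_layers:
  "prod_list (map (\<lambda>j. Poly_Mapping.single (f j) (1::'k::field)) [0..<t]) = Poly_Mapping.single (\<Sum>j<t. f j) 1"
  for f :: "nat \<Rightarrow> nat \<Rightarrow>\<^sub>0 nat"
  using prod.distinct_set_conv_list[of "[0..<t]" "\<lambda>j. Poly_Mapping.single (f j) (1::'k)"]
  by (simp add: single_sum atLeast0LessThan)

text \<open>The entry of \<open>a\<close> at \<open>i\<close> counts the levels \<open>j\<close>
  below it. The number \<open>t\<close> of layers is the largest entry of \<open>a\<close>.\<close>

lemma exp_layers:
  fixes a :: "nat \<Rightarrow>\<^sub>0 nat"
  obtains t where "a = (\<Sum>j<t. indicator_exp {i. j < Poly_Mapping.lookup a i})"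
    "\<And>j. j < t \<Longrightarrow> {i. j < Poly_Mapping.lookup a i} \<noteq> {}" "\<And>j. t \<le> j \<Longrightarrow> {i. j < Poly_Mapping.lookup a i} = {}"
proof -
  let ?S = "\<lambda>j. {i. j < Poly_Mapping.lookup a i}"
  have sub: "?S j \<subseteq> Poly_Mapping.keys a" for j by (auto simp: in_keys_iff)
  have fin: "finite (?S j)" for j by (rule finite_subset[OF sub finite_keys])
  \<comment> \<open>The total degree bounds every entry, so the layer at that level is
    empty.\<close>
  have "\<exists>t. ?S t = {}"
  proof
    have "Poly_Mapping.lookup a i \<le> (\<Sum>i\<in>Poly_Mapping.keys a. Poly_Mapping.lookup a i)" for i
    proof (cases "i \<in> Poly_Mapping.keys a")
      case True
      then show ?thesis
        by (rule member_le_sum[where f = "Poly_Mapping.lookup a", OF _ le0 finite_keys])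
    next
      case False
      then have "Poly_Mapping.lookup a i = 0" unfolding in_keys_iff by blast
      then show ?thesis by (simp only: le0)
    qed
    then show "?S (\<Sum>i\<in>Poly_Mapping.keys a. Poly_Mapping.lookup a i) = {}"
      by (simp add: not_less)
  qed
  define t where "t = (LEAST t. ?S t = {})"
  have t: "?S t = {}" unfolding t_def by (rule LeastI_ex) fact
  have "?S j \<noteq> {}" if "j < t" for j 
    using not_less_Least[of j "\<lambda>t. ?S t = {}"] that unfolding t_def by blast
  moreover have "?S j = {}" if "t \<le> j" for j
  proof -
    have "?S j \<subseteq> ?S t" using that by auto
    then show ?thesis using t by blast
  qed
  moreover have "a = (\<Sum>j<t. indicator_exp (?S j))"
  proof (rule poly_mapping_eqI)
    fix i
    have "Poly_Mapping.lookup a i \<le> t" using t by (auto simp: not_less)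
    then have "{..<t} \<inter> {j. j < Poly_Mapping.lookup a i} = {..<Poly_Mapping.lookup a i}" by auto
    then show "Poly_Mapping.lookup a i = Poly_Mapping.lookup (\<Sum>j<t. indicator_exp (?S j)) i"
      by (simp add: lookup_sum lookup_indicator_exp fin of_bool_def sum.If_cases)
  qed
  ultimately show ?thesis using that by blast
qed

theorem theorem1p2:
  fixes n l :: nat and \<Delta> :: "nat set set"
    and R :: "('k::field) mpoly ring" and I :: "'k mpoly set"
  assumes "n \<ge> 1"
    and "matroid n \<Delta>"
    and "R = mpoly_ring n"
    and "I = stanley_reisner_ideal n \<Delta>"
    and "l \<ge> 1"
  shows "min_gens n (symbolic_power R I l) =
    {prod_list ms |ms cs :: nat list.
       length cs = length ms \<and>
       (\<forall>i<length ms.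
          1 \<le> cs ! i \<and> enat (cs ! i) \<le> ideal_height R I \<and>
          ms ! i \<in> squarefree_monomials n \<and>
          ms ! i \<in> min_gens n (symbolic_power R I (cs ! i))) \<and>
       sum_list cs = l \<and>
       (\<forall>i. Suc i < length ms \<longrightarrow> supp n (ms ! i) \<supseteq> supp n (ms ! Suc i))}"
    (is "_ = ?RHS")
proof -
  note M = assms(2)
  let ?x = "\<lambda>a. Poly_Mapping.single a (1::'k)"
  have gens: "min_gens n (symbolic_power R I c) = ?x ` minimal_exps n (symbolic_exps n \<Delta> c)" for c
    unfolding assms(3,4) symbolic_power_stanley_reisner[OF M]
    by (rule min_gens_monomial_ideal[OF up_closed_symbolic_exps])
  have inj: "?x a = ?x b \<longleftrightarrow> a = b" for a b
  proof
    assume "?x a = ?x b"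
    then have "Poly_Mapping.keys (?x a) = Poly_Mapping.keys (?x b)" by simp
    then show "a = b" by simp
  qed simp
  have "?x ` minimal_exps n (symbolic_exps n \<Delta> l) = ?RHS"
  proof (intro equalityI subsetI)
    fix m assume "m \<in> ?x ` minimal_exps n (symbolic_exps n \<Delta> l)"
    then obtain a where a: "m = ?x a" "a \<in> minimal_exps n (symbolic_exps n \<Delta> l)" by blast
    define S where "S j = {i. j < Poly_Mapping.lookup a i}" for j
    obtain t where t: "a = (\<Sum>j<t. indicator_exp (S j))" "\<And>j. j < t \<Longrightarrow> S j \<noteq> {}" "\<And>j. t \<le> j \<Longrightarrow> S j = {}"
      using exp_layers[of a] unfolding S_def by blast
    have S: "antimono S" "\<And>j. S j \<subseteq> {1..n}"
    proof -
      show "antimono S" by (auto simp: antimono_def S_def)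
      have "S j \<subseteq> Poly_Mapping.keys a" for j by (auto simp: S_def in_keys_iff)
      then show "\<And>j. S j \<subseteq> {1..n}" using a(2) by (auto simp: minimal_exps_def)
    qed
    have min: "(\<Sum>j<t. nullity \<Delta> (S j)) = l" "\<And>j i. j < t \<Longrightarrow> i \<in> S j \<Longrightarrow> nullity \<Delta> (S j - {i}) < nullity \<Delta> (S j)"
      using symbolic_exps_minimal_layers[OF M S t(3) assms(5) t(1)] a(2) by (auto simp: minimal_exps_def)
    \<comment> \<open>A nonempty layer has an element whose removal lowers its nullity, so that
      nullity is positive.\<close>
    have pos: "1 \<le> nullity \<Delta> (S j)" if "j < t" for j using min(2)[OF that] t(2)[OF that] by fastforce
    \<comment> \<open>The factors are the squarefree monomials of the layers, outermost first, and
      the integers \<open>cs\<close> are their nullities.\<close>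
    define ms where "ms = map (\<lambda>j. ?x (indicator_exp (S j))) [0..<t]"
    define cs where "cs = map (\<lambda>j. nullity \<Delta> (S j)) [0..<t]"
    have "m = prod_list ms" unfolding ms_def prod_list_layers a(1) using t(1) by simp
    moreover have "length cs = length ms" by (simp add: ms_def cs_def)
    moreover have "1 \<le> cs ! i \<and> enat (cs ! i) \<le> ideal_height R I \<and>
          ms ! i \<in> squarefree_monomials n \<and> ms ! i \<in> min_gens n (symbolic_power R I (cs ! i))"
      if "i < length ms" for i
    proof -
      have i: "i < t" "ms ! i = ?x (indicator_exp (S i))" "cs ! i = nullity \<Delta> (S i)"
        using that by (simp_all add: ms_def cs_def)
      have "enat (nullity \<Delta> (S i)) \<le> ideal_height R I"
        unfolding assms(3,4)
      proof (rule ideal_height_stanley_reisner_ge)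
        fix F assume "F \<in> facets \<Delta>"
        then have "nullity \<Delta> (S i) \<le> card (S i - F)" by (rule nullity_le[OF M])
        also have "\<dots> \<le> card ({1..n} - F)" using S(2)[of i] by (intro card_mono) auto
        finally show "nullity \<Delta> (S i) \<le> card ({1..n} - F)" .
      qed
      moreover have "ms ! i \<in> squarefree_monomials n"
        unfolding squarefree_monomials_def i(2) prod_var[symmetric] using S(2)[of i] by blast
      moreover have "indicator_exp (S i) \<in> minimal_exps n (symbolic_exps n \<Delta> (cs ! i))"
        unfolding i(3) using indicator_minimal_iff[OF M S(2) pos[OF i(1)]] min(2)[OF i(1)] by blast
      ultimately show ?thesis using pos[OF i(1)] i by (simp add: gens)
    qed
    moreover have "sum_list cs = l"
      unfolding cs_def using min(1) sum.distinct_set_conv_list[of "[0..<t]" "\<lambda>j. nullity \<Delta> (S j)"]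
      by (simp add: atLeast0LessThan)
    moreover have "supp n (ms ! i) \<supseteq> supp n (ms ! Suc i)" if "Suc i < length ms" for i
    proof -
      have "ms ! i = ?x (indicator_exp (S i))" "ms ! Suc i = ?x (indicator_exp (S (Suc i)))"
        using that by (simp_all add: ms_def del: upt_Suc)
      then show ?thesis
        using antimonoD[OF S(1), of i "Suc i"] by (simp only: supp_indicator[OF S(2)] image_mono)
    qed
    ultimately show "m \<in> ?RHS" by blast
  next
    \<comment> \<open>Conversely, the supports of the given factors serve as layers.\<close>
    fix m assume "m \<in> ?RHS"
    then obtain ms and cs :: "nat list" where m: "m = prod_list ms" and len: "length cs = length ms"
      and ms: "\<And>i. i < length ms \<Longrightarrow> 1 \<le> cs ! i \<and> ms ! i \<in> squarefree_monomials n \<and>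
          ms ! i \<in> min_gens n (symbolic_power R I (cs ! i))"
      and sum: "sum_list cs = l"
      and chain: "\<And>i. Suc i < length ms \<Longrightarrow> supp n (ms ! i) \<supseteq> supp n (ms ! Suc i)"
      by blast
    let ?t = "length ms"
    have "\<exists>S. S \<subseteq> {1..n} \<and> ms ! i = ?x (indicator_exp S)" if "i < ?t" for i
      using ms[OF that] by (auto simp: squarefree_monomials_def prod_var)
    then obtain f where f: "\<And>i. i < ?t \<Longrightarrow> f i \<subseteq> {1..n} \<and> ms ! i = ?x (indicator_exp (f i))" by metis
    \<comment> \<open>The empty set beyond the last factor extends the chain to a decreasing
      sequence on all indices.\<close>
    define S where "S j = (if j < ?t then f j else {})" for j
    have S2: "S j \<subseteq> {1..n}" for j using f by (simp add: S_def)
    have S1: "antimono S"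
    proof (rule decseq_SucI)
      fix j
      show "S (Suc j) \<subseteq> S j"
      proof (cases "Suc j < ?t")
        case True
        then have "(var ` S (Suc j) :: 'k mpoly set) \<subseteq> var ` S j"
          using chain[OF True] f[OF True] f[of j] by (simp add: S_def supp_indicator)
        then show ?thesis using inj_image_subset_iff[OF inj_var] by blast
      qed (simp add: S_def)
    qed
    have ms_eq: "ms = map (\<lambda>j. ?x (indicator_exp (S j))) [0..<?t]"
      by (rule nth_equalityI) (use f in \<open>simp_all add: S_def\<close>)
    have null: "nullity \<Delta> (S j) = cs ! j" "\<And>i. i \<in> S j \<Longrightarrow> nullity \<Delta> (S j - {i}) < nullity \<Delta> (S j)" if "j < ?t" for j
    proof -
      have "?x (indicator_exp (S j)) \<in> ?x ` minimal_exps n (symbolic_exps n \<Delta> (cs ! j))"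
        using ms[OF that] f[OF that] that by (simp add: gens S_def)
      then obtain b where "?x (indicator_exp (S j)) = ?x b" "b \<in> minimal_exps n (symbolic_exps n \<Delta> (cs ! j))"
        by (rule imageE)
      then have "indicator_exp (S j) \<in> minimal_exps n (symbolic_exps n \<Delta> (cs ! j))"
        by (simp only: inj)
      then show "nullity \<Delta> (S j) = cs ! j" "\<And>i. i \<in> S j \<Longrightarrow> nullity \<Delta> (S j - {i}) < nullity \<Delta> (S j)"
        using indicator_minimal_iff[OF M S2, of "cs ! j" j] ms[OF that] by blast+
    qed
    define a where "a = (\<Sum>j<?t. indicator_exp (S j))"
    have "(\<Sum>j<?t. nullity \<Delta> (S j)) = l"
      using null(1) sum len by (simp add: sum_list_sum_nth atLeast0LessThan)
    moreover have "S j = {}" if "?t \<le> j" for j using that by (simp add: S_def)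
    \<comment> \<open>The layer criterion is now used from right to left, with the nullities
      \<open>cs ! j\<close> summing to \<open>l\<close>.\<close>
    ultimately have "a \<in> symbolic_exps n \<Delta> l \<and> (\<forall>i a'. a = a' + Poly_Mapping.single i 1 \<longrightarrow> a' \<notin> symbolic_exps n \<Delta> l)"
      using symbolic_exps_minimal_layers[OF M S1 S2 _ assms(5) a_def] null(2) by blast
    moreover have "Poly_Mapping.keys a \<subseteq> {1..n}"
    proof
      fix i assume "i \<in> Poly_Mapping.keys a"
      then have "(\<Sum>j<?t. Poly_Mapping.lookup (indicator_exp (S j)) i) \<noteq> 0"
        by (simp add: a_def in_keys_iff lookup_sum)
      then obtain j where "Poly_Mapping.lookup (indicator_exp (S j)) i \<noteq> 0" by (meson sum.neutral)
      then have "i \<in> S j" using finite_subset[OF S2] by (simp add: lookup_indicator_exp)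
      then show "i \<in> {1..n}" using S2 by blast
    qed
    ultimately have "a \<in> minimal_exps n (symbolic_exps n \<Delta> l)" by (simp add: minimal_exps_def)
    moreover have "m = ?x a" unfolding m a_def by (subst ms_eq) (rule prod_list_layers)
    ultimately show "m \<in> ?x ` minimal_exps n (symbolic_exps n \<Delta> l)" by blast
  qed
  then show ?thesis unfolding gens[of l] .
qed

end
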